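(* Let $m,n\ge 1$ be integers, $q=\min\{m,n\}$, $A\in\mathbb{R}^{m\times n}$, $c\in\mathbb{R}$ and $\mu\ge 0$. Let $f_1,f_2,g:\mathbb{R}^q\to(-\infty,\infty]$ be proper absolutely symmetric functions, and let $F_1,F_2,G$ be the associated spectral functions on $\mathbb{R}^{m\times n}$, i.e. $F_1(X)=f_1(\sigma(X))$, $F_2(X)=f_2(\sigma(X))$, $G(X)=g(\sigma(X))$ for all $X\in\mathbb{R}^{m\times n}$. Assume that $f_1$ is monotone under weak majorization on $\mathbb{R}^q_+$. Let $A=U\Sigma V^T$ be a singular value decomposition of $A$, with $U\in\mathbb{R}^{m\times m}$ and $V\in\mathbb{R}^{n\times n}$ orthogonal and $\Sigma=\mathrm{Diag}(\sigma(A))\in\mathbb{R}^{m\times n}$. Consider the matrix problem $$(\mathrm{P})\qquad \min_{X\in\mathbb{R}^{m\times n}} F_1(X-A)+\mu F_2(X)\quad\text{s.t.}\quad G(X)\le c,$$ and the vector problem $$(\mathrm{V})\qquad \min_{x\in\mathbb{R}^q} f_1(x-\sigma(A))+\mu f_2(x)\quad\text{s.t.}\quad g(x)\le c,\ \ x_1\ge\cdots\ge x_q\ge 0.$$ Then (P) admits an optimal solution if and only if (V) admits an optimal solution. Furthermore, if $x^*$ is an optimal solution of (V), then $X^*=U\,\mathrm{Diag}(x^* )\,V^T$ is an optimal solution of (P). Conversely, if $X^*$ is an optimal solution of (P), then $\sigma(X^* )$ is an optimal solution of (V).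
   Context: For $X\in\mathbb{R}^{m\times n}$ with $q=\min\{m,n\}$, $\sigma(X)\in\mathbb{R}^q$ is the vector of singular values in non-increasing order. For a vector $x$, $\mathrm{Diag}(x)$ is the generalized (possibly rectangular, size determined by context) diagonal matrix with diagonal $x$. A function is proper if it never takes the value $-\infty$ and is not identically $+\infty$. A proper function $f:\mathbb{R}^q\to(-\infty,\infty]$ is absolutely symmetric if $f(PJx)=f(x)$ for every $x$, every permutation matrix $P$ and every diagonal matrix $J$ with $J_{ii}\in\{\pm1\}$. For $x,y\in\mathbb{R}^q$ with components arranged in non-increasing order $x_{[1]}\ge\dots\ge x_{[q]}$, $y_{[1]}\ge\dots\ge y_{[q]}$, $x$ is weakly majorized by $y$, written $x\prec_w y$, if $\sum_{i=1}^k x_{[i]}\le\sum_{i=1}^k y_{[i]}$ for all $k=1,\dots,q$. A function $f:\mathbb{R}^q\to(-\infty,\infty]$ is monotone under weak majorization on $\mathbb{R}^q_+$ if, for all $x,y\in\mathbb{R}^q_+$ (nonnegative orthant), $x\prec_w y$ implies $f(x)\le f(y)$. An optimal solution is a feasible point (one satisfying the constraints) whose objective value is no larger than that of any other feasible point. *)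

theory Defs
  imports
    Jordan_Normal_Form.Char_Poly
    "HOL-Combinatorics.Permutations"
    "HOL-Library.Extended_Real"
begin

text \<open>
  A matrix in \<open>\<real>\<^sup>m\<^sup>\<times>\<^sup>n\<close> is an element of \<open>carrier_mat m n\<close> and a vector in \<open>\<real>\<^sup>q\<close> an element of
  \<open>carrier_vec q\<close>, with indices starting at 0. A function from \<open>\<real>\<^sup>q\<close> to the extended reals is
  an HOL function on all vectors of which only the values on \<open>carrier_vec q\<close> are ever used.
\<close>

definition Diag :: "nat \<Rightarrow> nat \<Rightarrow> real vec \<Rightarrow> real mat" where
  "Diag m n x = mat m n (\<lambda>(i, j). if i = j then x $ i else 0)"

text \<open>
  Not the library's \<^const>\<open>orthogonal_mat\<close>, which only asks for nonzero, pairwise orthogonal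
  columns that need not have length one.
\<close>

definition orthogonal_matrix :: "nat \<Rightarrow> real mat \<Rightarrow> bool" where
  "orthogonal_matrix n U \<longleftrightarrow> U \<in> carrier_mat n n \<and> U\<^sup>T * U = 1\<^sub>m n \<and> U * U\<^sup>T = 1\<^sub>m n"

text \<open>
  The singular values are the square roots of the \<open>min m n\<close> largest eigenvalues of \<open>X\<^sup>T X\<close>, counted
  with multiplicity; if \<open>m < n\<close>, the \<open>n - m\<close> eigenvalues left out are zero. All eigenvalues of
  \<open>X\<^sup>T X\<close> are real, so the list below has length \<open>n\<close> and \<open>!\<close> never leaves its range.
\<close>

definition singular_values :: "real mat \<Rightarrow> real vec" where
  "singular_values X =
     vec (min (dim_row X) (dim_col X))
       (\<lambda>i. sqrt (rev (sorted_list_of_multiset (proots (char_poly (X\<^sup>T * X)))) ! i))"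

definition spectral_function :: "(real vec \<Rightarrow> ereal) \<Rightarrow> real mat \<Rightarrow> ereal" where
  "spectral_function f X = f (singular_values X)"

definition proper :: "nat \<Rightarrow> (real vec \<Rightarrow> ereal) \<Rightarrow> bool" where
  "proper q f \<longleftrightarrow>
     (\<forall>x\<in>carrier_vec q. f x \<noteq> -\<infinity>) \<and> (\<exists>x\<in>carrier_vec q. f x \<noteq> \<infinity>)"

definition permutation_matrix :: "nat \<Rightarrow> real mat \<Rightarrow> bool" where
  "permutation_matrix q P \<longleftrightarrow>
     (\<exists>p. p permutes {0..<q} \<and> P = mat q q (\<lambda>(i, j). if j = p i then 1 else 0))"

definition sign_matrix :: "nat \<Rightarrow> real mat \<Rightarrow> bool" where
  "sign_matrix q J \<longleftrightarrow>
     J \<in> carrier_mat q q \<and> diagonal_mat J \<and> (\<forall>i<q. J $$ (i, i) \<in> {1, -1})"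

definition absolutely_symmetric :: "nat \<Rightarrow> (real vec \<Rightarrow> ereal) \<Rightarrow> bool" where
  "absolutely_symmetric q f \<longleftrightarrow>
     (\<forall>x\<in>carrier_vec q. \<forall>P J. permutation_matrix q P \<longrightarrow> sign_matrix q J \<longrightarrow>
        f ((P * J) *\<^sub>v x) = f x)"

definition decreasing_rearrangement :: "real vec \<Rightarrow> real list" where
  "decreasing_rearrangement x = rev (sort (list_of_vec x))"

definition weakly_majorized :: "real vec \<Rightarrow> real vec \<Rightarrow> bool" (infix "\<prec>\<^sub>w" 50) where
  "x \<prec>\<^sub>w y \<longleftrightarrow> dim_vec x = dim_vec y \<and>
     (\<forall>k\<in>{1..dim_vec x}.
        (\<Sum>i<k. decreasing_rearrangement x ! i) \<le> (\<Sum>i<k. decreasing_rearrangement y ! i))"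

definition nonneg_orthant :: "nat \<Rightarrow> real vec set" where
  "nonneg_orthant q = {x \<in> carrier_vec q. \<forall>i<q. 0 \<le> x $ i}"

definition weak_majorization_monotone :: "nat \<Rightarrow> (real vec \<Rightarrow> ereal) \<Rightarrow> bool" where
  "weak_majorization_monotone q f \<longleftrightarrow>
     (\<forall>x\<in>nonneg_orthant q. \<forall>y\<in>nonneg_orthant q. x \<prec>\<^sub>w y \<longrightarrow> f x \<le> f y)"

definition nonneg_decreasing_vecs :: "nat \<Rightarrow> real vec set" where
  "nonneg_decreasing_vecs q =
     {x \<in> carrier_vec q. (\<forall>i j. i \<le> j \<longrightarrow> j < q \<longrightarrow> x $ j \<le> x $ i) \<and> (\<forall>i<q. 0 \<le> x $ i)}"

definition optimal_solution :: "'a set \<Rightarrow> ('a \<Rightarrow> ereal) \<Rightarrow> 'a \<Rightarrow> bool" where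
  "optimal_solution S h x \<longleftrightarrow> x \<in> S \<and> (\<forall>y\<in>S. h x \<le> h y)"

text \<open>
  In the two problems the product with \<open>\<mu>\<close> is that of \<^typ>\<open>ereal\<close>, so \<open>0 * \<infinity> = 0\<close>. The sums
  never have the form \<open>\<infinity> - \<infinity>\<close> for proper functions and \<open>\<mu> \<ge> 0\<close>.
\<close>

definition matrix_problem_solution ::
  "nat \<Rightarrow> nat \<Rightarrow> (real mat \<Rightarrow> ereal) \<Rightarrow> (real mat \<Rightarrow> ereal) \<Rightarrow> (real mat \<Rightarrow> ereal) \<Rightarrow>
   real mat \<Rightarrow> real \<Rightarrow> real \<Rightarrow> real mat \<Rightarrow> bool" where
  "matrix_problem_solution m n F\<^sub>1 F\<^sub>2 G A \<mu> c =
     optimal_solution {X \<in> carrier_mat m n. G X \<le> ereal c}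
       (\<lambda>X. F\<^sub>1 (X - A) + ereal \<mu> * F\<^sub>2 X)"

definition vector_problem_solution ::
  "nat \<Rightarrow> (real vec \<Rightarrow> ereal) \<Rightarrow> (real vec \<Rightarrow> ereal) \<Rightarrow> (real vec \<Rightarrow> ereal) \<Rightarrow>
   real vec \<Rightarrow> real \<Rightarrow> real \<Rightarrow> real vec \<Rightarrow> bool" where
  "vector_problem_solution q f\<^sub>1 f\<^sub>2 g s \<mu> c =
     optimal_solution {x \<in> nonneg_decreasing_vecs q. g x \<le> ereal c}
       (\<lambda>x. f\<^sub>1 (x - s) + ereal \<mu> * f\<^sub>2 x)"

end

theory Submission
  imports Defs Jordan_Normal_Form.Spectral_Radius
begin

text \<open>
  The matrix problem and the vector problem are compared through two maps. A feasible vector \<open>x\<close>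
  lifts to \<open>U Diag(x) V\<^sup>T\<close>, which has the singular values \<open>x\<close>; its difference to \<open>A\<close> is
  \<open>U Diag(x - \<sigma>(A)) V\<^sup>T\<close>, whose singular values are the absolute values of the entries of
  \<open>x - \<sigma>(A)\<close> in decreasing order. Absolute symmetry therefore makes the lift preserve the
  constraint and the objective (\<open>spectral_function_orthogonal_Diag\<close>). In the other direction
  \<open>X\<close> is sent to \<open>\<sigma>(X)\<close>. This preserves the constraint and the term of \<open>f\<^sub>2\<close>, and does not increase
  the objective because \<open>f\<^sub>1 (\<sigma>(X) - \<sigma>(A)) \<le> F\<^sub>1 (X - A)\<close> (\<open>spectral_function_diff_ge\<close>). So each map
  sends a feasible point to a feasible point with an objective value that is at most the old one,
  and hence minimizers to minimizers.

  The inequality for \<open>f\<^sub>1\<close> is Mirsky's theorem: the vector of the \<open>\<bar>\<sigma>\<^sub>i(X) - \<sigma>\<^sub>i(A)\<bar>\<close> is weakly majorized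
  by \<open>\<sigma>(X - A)\<close>. It is the Lidskii inequality for eigenvalues, applied to the symmetric dilations
  of the matrices: the dilation of \<open>X\<close> has the off-diagonal blocks \<open>X\<close> and \<open>X\<^sup>T\<close>, so its
  eigenvalues are the \<open>\<sigma>\<^sub>i(X)\<close>, their negatives and zeros, and choosing between the positions of
  \<open>\<sigma>\<^sub>i\<close> and of \<open>- \<sigma>\<^sub>i\<close> produces the absolute values. The Lidskii inequality follows, by the argument
  of Li and Mathias, from the monotonicity of sorted eigenvalues in the quadratic form and from
  the fact that the eigenvalues sum to the trace.

  Vectors of an orthonormal family and eigenvalues are indexed by functions on \<open>nat\<close> rather
  than collected in matrices, because the spectrum is reordered repeatedly and because only inner
  products with the family matter.
\<close>

section \<open>Decreasing rearrangements\<close>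

lemma sorting_permutation:
  fixes l :: "nat \<Rightarrow> real"
  obtains p where "p permutes {..<N}" and "antimono_on {..<N} (l \<circ> p)"
proof -
  define xs where "xs = map l [0..<N]"
  have "mset (rev (sort xs)) = mset xs" by simp
  then obtain p where p: "p permutes {..<length xs}" "permute_list p xs = rev (sort xs)"
    by (rule mset_eq_permutation)
  have pN: "p permutes {..<N}" using p(1) by (simp add: xs_def)
  have nth: "rev (sort xs) ! i = l (p i)" if "i < N" for i
  proof -
    have "p i < N" using permutes_in_image[OF pN, of i] that by simp
    then show ?thesis using permute_list_nth[OF p(1), of i] that unfolding p(2)
      by (simp add: xs_def)
  qed
  have "antimono_on {..<N} (l \<circ> p)"
  proof (rule monotone_onI)
    fix i j assume ij: "i \<in> {..<N}" "j \<in> {..<N}" "i \<le> j"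
    have "sorted_wrt (\<ge>) (rev (sort xs))"
      by (simp add: sorted_wrt_rev)
    then have "rev (sort xs) ! j \<le> rev (sort xs) ! i"
      using ij by (cases "i = j") (auto simp: sorted_wrt_iff_nth_less xs_def)
    then show "(l \<circ> p) j \<le> (l \<circ> p) i" using nth ij by simp
  qed
  with pN show ?thesis by (rule that)
qed

lemma rev_sort_eq_map:
  fixes l :: "nat \<Rightarrow> real"
  assumes "antimono_on {..<N} l" and "mset xs = mset (map l [0..<N])"
  shows "rev (sort xs) = map l [0..<N]"
proof -
  have "sorted_wrt (\<ge>) (map l [0..<N])"
    using assms(1) by (auto simp: sorted_wrt_iff_nth_less monotone_on_def)
  then have "sorted (rev (map l [0..<N]))" by (simp add: sorted_wrt_rev)
  moreover have "mset (rev (map l [0..<N])) = mset xs" using assms(2) by simp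
  ultimately have "sort xs = rev (map l [0..<N])" by (intro properties_for_sort) simp_all
  then show ?thesis by simp
qed

section \<open>Orthonormal families\<close>

definition orthonormal :: "nat \<Rightarrow> nat \<Rightarrow> (nat \<Rightarrow> real vec) \<Rightarrow> bool" where
  "orthonormal N k v \<longleftrightarrow> (\<forall>i<k. v i \<in> carrier_vec N) \<and>
     (\<forall>i<k. \<forall>j<k. v i \<bullet> v j = (if i = j then 1 else 0))"

lemma orthonormal_carrier: "orthonormal N k v \<Longrightarrow> i < k \<Longrightarrow> v i \<in> carrier_vec N"
  and orthonormal_scalar_prod:
    "orthonormal N k v \<Longrightarrow> i < k \<Longrightarrow> j < k \<Longrightarrow> v i \<bullet> v j = (if i = j then 1 else 0)"
  by (auto simp: orthonormal_def)

lemma orthonormal_permute: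
  assumes "orthonormal N k v" "p permutes {..<k}"
  shows "orthonormal N k (v \<circ> p)"
  using assms permutes_in_image[OF assms(2)] permutes_inj[OF assms(2)]
  by (auto simp: orthonormal_def inj_eq)

text \<open>
  The vectors, padded with zero vectors, are the rows of an \<open>N \<times> N\<close> matrix with a zero row. Its
  determinant vanishes, so it has a kernel vector. This one dimension count serves for completing
  bases and for the min-max argument below.
\<close>
lemma ex_unit_orthogonal_vec:
  assumes "k < N" and v: "\<And>i. i < k \<Longrightarrow> v i \<in> carrier_vec N"
  obtains x :: "real vec"
    where "x \<in> carrier_vec N" "x \<bullet> x = 1" "\<And>i. i < k \<Longrightarrow> v i \<bullet> x = 0"
proof -
  define c where "c i = (if i < k then v i else 0\<^sub>v N)" for i
  define M where "M = mat\<^sub>r N N (\<lambda>i. if i = k then 0\<^sub>v N else c i)"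
  have M: "M \<in> carrier_mat N N" by (simp add: M_def)
  have "det M = 0" unfolding M_def
    by (rule det_row_0) (use assms in \<open>auto simp: c_def\<close>)
  then obtain y where y: "y \<in> carrier_vec N" "y \<noteq> 0\<^sub>v N" "M *\<^sub>v y = 0\<^sub>v N"
    using det_0_iff_vec_prod_zero[OF M] by auto
  have vy: "v i \<bullet> y = 0" if "i < k" for i
  proof -
    have "row M i = v i" unfolding M_def using that assms v[OF that]
      by (subst row_mat_of_row_fun) (auto simp: c_def)
    moreover have "(M *\<^sub>v y) $ i = row M i \<bullet> y" using M that assms by simp
    ultimately show ?thesis using y(3) that assms by simp
  qed
  have "y \<bullet> y > 0" using conjugate_square_greater_0_vec[of y] y(1,2) by auto
  then have "((1 / sqrt (y \<bullet> y)) \<cdot>\<^sub>v y) \<bullet> ((1 / sqrt (y \<bullet> y)) \<cdot>\<^sub>v y) = 1"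
    using y(1) by simp
  moreover have "v i \<bullet> ((1 / sqrt (y \<bullet> y)) \<cdot>\<^sub>v y) = 0" if "i < k" for i
    using vy[OF that] v[OF that] y(1) by simp
  ultimately show ?thesis using y(1) by (intro that[of "(1 / sqrt (y \<bullet> y)) \<cdot>\<^sub>v y"]) auto
qed

lemma orthonormal_extend:
  assumes "orthonormal N k v" "k \<le> N"
  obtains w where "orthonormal N N w" "\<And>i. i < k \<Longrightarrow> w i = v i"
proof -
  have "\<exists>w. orthonormal N N w \<and> (\<forall>i<k. w i = v i)" using assms(2,1)
  proof (induction k arbitrary: v rule: inc_induct)
    case base
    then show ?case by blast
  next
    case (step k)
    obtain x where x: "x \<in> carrier_vec N" "x \<bullet> x = 1" "\<And>i. i < k \<Longrightarrow> v i \<bullet> x = 0"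
      using ex_unit_orthogonal_vec[OF step.hyps(2), of v] step.prems
      by (auto simp: orthonormal_def)
    have "x \<bullet> v i = 0" if "i < k" for i
      using x(3)[OF that] comm_scalar_prod[OF x(1) orthonormal_carrier[OF step.prems that]] by simp
    with x step.prems have "orthonormal N (Suc k) (v(k := x))"
      by (auto simp: orthonormal_def less_Suc_eq)
    from step.IH[OF this] obtain w where "orthonormal N N w" "\<forall>i<Suc k. w i = (v(k := x)) i"
      by blast
    then show ?case by (intro exI[of _ w]) auto
  qed
  with that show ?thesis by blast
qed

definition cols_mat :: "nat \<Rightarrow> (nat \<Rightarrow> real vec) \<Rightarrow> real mat" where
  "cols_mat N v = mat N N (\<lambda>(i, j). v j $ i)"

lemma cols_mat_carrier [simp]: "cols_mat N v \<in> carrier_mat N N"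
  by (simp add: cols_mat_def)

lemma col_cols_mat:
  assumes "j < N" "v j \<in> carrier_vec N"
  shows "col (cols_mat N v) j = v j"
  using assms by (intro eq_vecI) (auto simp: cols_mat_def)

lemma orthonormal_cols_mat:
  assumes "orthonormal N N v"
  shows "orthogonal_matrix N (cols_mat N v)"
proof -
  define Q where "Q = cols_mat N v"
  have Q: "Q \<in> carrier_mat N N" by (simp add: Q_def)
  have "Q\<^sup>T * Q = 1\<^sub>m N"
  proof (rule eq_matI)
    fix a b assume ab: "a < dim_row (1\<^sub>m N :: real mat)" "b < dim_col (1\<^sub>m N :: real mat)"
    then have "(Q\<^sup>T * Q) $$ (a, b) = col Q a \<bullet> col Q b" using Q by simp
    then show "(Q\<^sup>T * Q) $$ (a, b) = 1\<^sub>m N $$ (a, b)"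
      using ab orthonormal_scalar_prod[OF assms, of a b] orthonormal_carrier[OF assms]
      by (simp add: Q_def col_cols_mat)
  qed (use Q in auto)
  moreover from this have "Q * Q\<^sup>T = 1\<^sub>m N"
    using mat_mult_left_right_inverse[of "Q\<^sup>T" N Q] Q by simp
  ultimately show ?thesis using Q by (simp add: orthogonal_matrix_def Q_def)
qed

text \<open>
  A square matrix with orthonormal columns also has orthonormal rows. This is where a full family
  is shown to be complete, which gives the expansion of inner products below.
\<close>
lemma orthonormal_dual:
  assumes "orthonormal N N v" "i < N" "j < N"
  shows "(\<Sum>r<N. v r $ i * v r $ j) = (if i = j then 1 else 0)"
proof -
  define Q where "Q = cols_mat N v"
  have "(Q * Q\<^sup>T) $$ (i, j) = (if i = j then 1 else 0)"
    using orthonormal_cols_mat[OF assms(1)] assms by (simp add: orthogonal_matrix_def Q_def)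
  moreover have "(Q * Q\<^sup>T) $$ (i, j) = (\<Sum>r<N. v r $ i * v r $ j)"
    using assms by (simp add: Q_def cols_mat_def scalar_prod_def atLeast0LessThan)
  ultimately show ?thesis by simp
qed

lemma scalar_prod_sum: "x \<in> carrier_vec N \<Longrightarrow> y \<bullet> x = (\<Sum>i<N. y $ i * x $ i)"
  by (simp add: scalar_prod_def atLeast0LessThan)

lemma parseval:
  fixes x y :: "real vec"
  assumes v: "orthonormal N N v" and x: "x \<in> carrier_vec N" and y: "y \<in> carrier_vec N"
  shows "x \<bullet> y = (\<Sum>r<N. (v r \<bullet> x) * (v r \<bullet> y))"
proof -
  have "(\<Sum>r<N. (v r \<bullet> x) * (v r \<bullet> y)) =
      (\<Sum>r<N. \<Sum>i<N. \<Sum>j<N. x $ i * y $ j * (v r $ i * v r $ j))"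
    by (simp add: scalar_prod_sum[OF x] scalar_prod_sum[OF y] sum_product mult_ac)
  also have "\<dots> = (\<Sum>i<N. \<Sum>r<N. \<Sum>j<N. x $ i * y $ j * (v r $ i * v r $ j))"
    by (rule sum.swap)
  also have "\<dots> = (\<Sum>i<N. \<Sum>j<N. \<Sum>r<N. x $ i * y $ j * (v r $ i * v r $ j))"
    by (intro sum.cong refl sum.swap)
  also have "\<dots> = (\<Sum>i<N. \<Sum>j<N. x $ i * y $ j * (if i = j then 1 else 0))"
    by (intro sum.cong refl) (simp add: sum_distrib_left[symmetric] orthonormal_dual[OF v])
  also have "\<dots> = x \<bullet> y" by (simp add: scalar_prod_sum[OF y] if_distrib cong: if_cong)
  finally show ?thesis ..
qed

lemma orthonormal_zeroI:
  assumes "orthonormal N N v" "x \<in> carrier_vec N" "\<And>r. r < N \<Longrightarrow> v r \<bullet> x = 0"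
  shows "x = 0\<^sub>v N"
proof -
  have "x \<bullet> x = 0" using parseval[OF assms(1,2,2)] assms(3) by simp
  then show ?thesis using conjugate_square_eq_0_vec[of x N] assms(2) by simp
qed

lemma orthonormal_eqI:
  assumes "orthonormal N N v" "x \<in> carrier_vec N" "y \<in> carrier_vec N"
    and "\<And>r. r < N \<Longrightarrow> v r \<bullet> x = v r \<bullet> y"
  shows "x = y"
proof -
  have "x - y = 0\<^sub>v N"
    by (rule orthonormal_zeroI[OF assms(1)])
      (use assms in \<open>simp_all add: scalar_prod_minus_distrib[OF orthonormal_carrier[OF assms(1)]]\<close>)
  then have "(x - y) $ i = 0" if "i < N" for i using that by simp
  with assms(2,3) show ?thesis by (intro eq_vecI) auto
qed

text \<open>
  Otherwise the first \<open>N\<close> vectors form a basis to which the next unit vector is orthogonal.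
\<close>
lemma orthonormal_card_le:
  assumes "orthonormal N k v"
  shows "k \<le> N"
proof (rule ccontr)
  assume "\<not> k \<le> N"
  then have N: "N < k" by simp
  have v: "orthonormal N N v" unfolding orthonormal_def
    using orthonormal_carrier[OF assms] orthonormal_scalar_prod[OF assms] N by simp
  have "v N = 0\<^sub>v N"
    by (rule orthonormal_zeroI[OF v])
      (use orthonormal_carrier[OF assms] orthonormal_scalar_prod[OF assms] N in simp_all)
  then show False using orthonormal_scalar_prod[OF assms N N] by simp
qed

section \<open>Eigenbases of symmetric matrices\<close>

definition eigenbasis :: "nat \<Rightarrow> real mat \<Rightarrow> (nat \<Rightarrow> real vec) \<Rightarrow> (nat \<Rightarrow> real) \<Rightarrow> bool" where
  "eigenbasis N S v l \<longleftrightarrow> S \<in> carrier_mat N N \<and> orthonormal N N v \<and>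
     (\<forall>j<N. S *\<^sub>v v j = l j \<cdot>\<^sub>v v j)"

lemma eigenbasis_permute:
  assumes "eigenbasis N S v l" "p permutes {..<N}"
  shows "eigenbasis N S (v \<circ> p) (l \<circ> p)"
  using assms orthonormal_permute[of N N v p] permutes_in_image[OF assms(2)]
  by (auto simp: eigenbasis_def)

lemma symmetric_adjoint:
  assumes "S \<in> carrier_mat N N" "S\<^sup>T = S" "x \<in> carrier_vec N" "y \<in> carrier_vec N"
  shows "(S *\<^sub>v x) \<bullet> y = x \<bullet> (S *\<^sub>v (y :: real vec))"
  using transpose_vec_mult_scalar[OF assms(1,4,3)] assms(2) by simp

lemma eigenbasis_entries:
  assumes E: "eigenbasis N S v l" and ij: "i < N" "j < N"
  shows "S $$ (i, j) = (\<Sum>r<N. l r * v r $ i * v r $ j)"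
proof -
  have S: "S \<in> carrier_mat N N" and v: "orthonormal N N v" using E by (auto simp: eigenbasis_def)
  have Sv: "(\<Sum>k<N. S $$ (i, k) * v r $ k) = l r * v r $ i" if "r < N" for r
  proof -
    have "(S *\<^sub>v v r) $ i = (l r \<cdot>\<^sub>v v r) $ i" using E that by (simp add: eigenbasis_def)
    then show ?thesis using S ij orthonormal_carrier[OF v that]
      by (simp add: scalar_prod_def atLeast0LessThan)
  qed
  have "(\<Sum>r<N. l r * v r $ i * v r $ j) = (\<Sum>r<N. \<Sum>k<N. S $$ (i, k) * (v r $ k * v r $ j))"
    by (intro sum.cong refl) (simp add: Sv[symmetric] sum_distrib_right mult.assoc)
  also have "\<dots> = (\<Sum>k<N. \<Sum>r<N. S $$ (i, k) * (v r $ k * v r $ j))" by (rule sum.swap)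
  also have "\<dots> = (\<Sum>k<N. S $$ (i, k) * (if k = j then 1 else 0))"
    by (intro sum.cong refl) (simp add: sum_distrib_left[symmetric] orthonormal_dual[OF v] ij)
  also have "\<dots> = S $$ (i, j)" using ij by (simp add: if_distrib cong: if_cong)
  finally show ?thesis ..
qed

lemma eigenbasis_symmetric:
  assumes "eigenbasis N S v l"
  shows "S\<^sup>T = S"
proof -
  have "S \<in> carrier_mat N N" using assms by (simp add: eigenbasis_def)
  then show ?thesis
    by (intro eq_matI) (auto simp: eigenbasis_entries[OF assms] mult_ac)
qed

lemma ex_matrix_with_eigenbasis:
  assumes "orthonormal N N v"
  obtains S where "eigenbasis N S v l"
proof -
  define S where "S = mat N N (\<lambda>(i, j). \<Sum>r<N. l r * v r $ i * v r $ j)"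
  have "S *\<^sub>v v j = l j \<cdot>\<^sub>v v j" if j: "j < N" for j
  proof (rule eq_vecI)
    fix i assume "i < dim_vec (l j \<cdot>\<^sub>v v j)"
    with orthonormal_carrier[OF assms j] have i: "i < N" by simp
    have "(S *\<^sub>v v j) $ i = (\<Sum>k<N. (\<Sum>r<N. l r * v r $ i * v r $ k) * v j $ k)"
      using i j orthonormal_carrier[OF assms j] by (simp add: S_def scalar_prod_def atLeast0LessThan)
    also have "\<dots> = (\<Sum>k<N. \<Sum>r<N. l r * v r $ i * (v r $ k * v j $ k))"
      by (simp add: sum_distrib_right mult.assoc)
    also have "\<dots> = (\<Sum>r<N. \<Sum>k<N. l r * v r $ i * (v r $ k * v j $ k))" by (rule sum.swap)
    also have "\<dots> = (\<Sum>r<N. l r * v r $ i * (v r \<bullet> v j))"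
      by (simp add: sum_distrib_left scalar_prod_sum[OF orthonormal_carrier[OF assms j]])
    also have "\<dots> = (\<Sum>r<N. l r * v r $ i * (if r = j then 1 else 0))"
      by (intro sum.cong refl) (simp add: orthonormal_scalar_prod[OF assms] j)
    also have "\<dots> = (l j \<cdot>\<^sub>v v j) $ i"
      using j i orthonormal_carrier[OF assms j] by (simp add: if_distrib cong: if_cong)
    finally show "(S *\<^sub>v v j) $ i = (l j \<cdot>\<^sub>v v j) $ i" .
  qed (use orthonormal_carrier[OF assms j] in \<open>simp add: S_def\<close>)
  then have "eigenbasis N S v l" using assms by (simp add: eigenbasis_def S_def)
  then show ?thesis by (rule that)
qed

lemma eigenbasis_quadratic_form:
  assumes E: "eigenbasis N S v l" and x: "x \<in> carrier_vec N"
  shows "x \<bullet> (S *\<^sub>v x) = (\<Sum>r<N. l r * (v r \<bullet> x)\<^sup>2)"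
proof -
  have S: "S \<in> carrier_mat N N" and v: "orthonormal N N v" using E by (auto simp: eigenbasis_def)
  have "v r \<bullet> (S *\<^sub>v x) = l r * (v r \<bullet> x)" if "r < N" for r
    using symmetric_adjoint[OF S eigenbasis_symmetric[OF E] orthonormal_carrier[OF v that] x]
      E that x orthonormal_carrier[OF v that] by (simp add: eigenbasis_def)
  then show ?thesis using parseval[OF v x, of "S *\<^sub>v x"] S x
    by (simp add: power2_eq_square mult_ac)
qed

lemma eigenbasis_trace:
  assumes E: "eigenbasis N S v l"
  shows "(\<Sum>i<N. S $$ (i, i)) = (\<Sum>r<N. l r)"
proof -
  have v: "orthonormal N N v" using E by (simp add: eigenbasis_def)
  have "(\<Sum>i<N. S $$ (i, i)) = (\<Sum>i<N. \<Sum>r<N. l r * (v r $ i * v r $ i))"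
    by (simp add: eigenbasis_entries[OF E] mult.assoc)
  also have "\<dots> = (\<Sum>r<N. \<Sum>i<N. l r * (v r $ i * v r $ i))" by (rule sum.swap)
  also have "\<dots> = (\<Sum>r<N. l r * (v r \<bullet> v r))"
    by (simp add: sum_distrib_left scalar_prod_sum[OF orthonormal_carrier[OF v]])
  also have "\<dots> = (\<Sum>r<N. l r)" by (simp add: orthonormal_scalar_prod[OF v])
  finally show ?thesis .
qed

section \<open>The spectral theorem\<close>

text \<open>
  There is a complex eigenvector \<open>a + \<i> b\<close>. Comparing \<open>b \<bullet> S a\<close> with \<open>S b \<bullet> a\<close> shows that the
  eigenvalue is real; then \<open>a\<close> and \<open>b\<close> are themselves eigenvectors unless they vanish.
\<close>
lemma real_symmetric_has_eigenvector:
  fixes S :: "real mat"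
  assumes S: "S \<in> carrier_mat N N" "S\<^sup>T = S" and "N > 0"
  obtains t x where "x \<in> carrier_vec N" "x \<noteq> 0\<^sub>v N" "S *\<^sub>v x = t \<cdot>\<^sub>v x"
proof -
  define C where "C = map_mat complex_of_real S"
  have C: "C \<in> carrier_mat N N" using S by (simp add: C_def)
  from spectrum_non_empty[OF C \<open>N > 0\<close>] obtain z w
    where w: "w \<in> carrier_vec N" "w \<noteq> 0\<^sub>v N" "C *\<^sub>v w = z \<cdot>\<^sub>v w"
    using C by (auto simp: spectrum_def eigenvalue_def eigenvector_def)
  define a b where "a = map_vec Re w" and "b = map_vec Im w"
  have ab: "a \<in> carrier_vec N" "b \<in> carrier_vec N" using w(1) by (auto simp: a_def b_def)
  have Cw: "(\<Sum>k<N. of_real (S $$ (i, k)) * w $ k) = z * w $ i" if "i < N" for i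
  proof -
    have "(C *\<^sub>v w) $ i = (z \<cdot>\<^sub>v w) $ i" using w(3) by simp
    then show ?thesis using that S w(1) by (simp add: C_def scalar_prod_def atLeast0LessThan)
  qed
  have Sa: "S *\<^sub>v a = Re z \<cdot>\<^sub>v a - Im z \<cdot>\<^sub>v b"
  proof (rule eq_vecI)
    fix i assume "i < dim_vec (Re z \<cdot>\<^sub>v a - Im z \<cdot>\<^sub>v b)"
    then have i: "i < N" using ab by simp
    have "(S *\<^sub>v a) $ i = Re (\<Sum>k<N. of_real (S $$ (i, k)) * w $ k)"
      using i S w(1) by (simp add: a_def scalar_prod_def atLeast0LessThan)
    then show "(S *\<^sub>v a) $ i = (Re z \<cdot>\<^sub>v a - Im z \<cdot>\<^sub>v b) $ i"
      using i w(1) by (simp add: Cw[OF i] a_def b_def)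
  qed (use S ab in simp)
  have Sb: "S *\<^sub>v b = Im z \<cdot>\<^sub>v a + Re z \<cdot>\<^sub>v b"
  proof (rule eq_vecI)
    fix i assume "i < dim_vec (Im z \<cdot>\<^sub>v a + Re z \<cdot>\<^sub>v b)"
    then have i: "i < N" using ab by simp
    have "(S *\<^sub>v b) $ i = Im (\<Sum>k<N. of_real (S $$ (i, k)) * w $ k)"
      using i S w(1) by (simp add: b_def scalar_prod_def atLeast0LessThan)
    then show "(S *\<^sub>v b) $ i = (Im z \<cdot>\<^sub>v a + Re z \<cdot>\<^sub>v b) $ i"
      using i w(1) by (simp add: Cw[OF i] a_def b_def)
  qed (use S ab in simp)
  have ne: "a \<noteq> 0\<^sub>v N \<or> b \<noteq> 0\<^sub>v N"
  proof (rule ccontr)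
    assume "\<not> ?thesis"
    then have "a $ i = 0 \<and> b $ i = 0" if "i < N" for i using that by simp
    then have "w = 0\<^sub>v N" using w(1) by (intro eq_vecI) (auto simp: a_def b_def complex_eq_iff)
    with w(2) show False by simp
  qed
  have "b \<bullet> (S *\<^sub>v a) = Re z * (b \<bullet> a) - Im z * (b \<bullet> b)"
    using ab by (simp add: Sa scalar_prod_minus_distrib[of _ N])
  moreover have "(S *\<^sub>v b) \<bullet> a = Im z * (a \<bullet> a) + Re z * (b \<bullet> a)"
    using ab by (simp add: Sb add_scalar_prod_distrib[of _ N])
  moreover have "(S *\<^sub>v b) \<bullet> a = b \<bullet> (S *\<^sub>v a)" using symmetric_adjoint[OF S ab(2,1)] .
  ultimately have "Im z * (a \<bullet> a + b \<bullet> b) = 0" by (simp add: algebra_simps)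
  moreover have "a \<bullet> a + b \<bullet> b > 0"
    using ne conjugate_square_greater_0_vec[of a N] conjugate_square_greater_0_vec[of b N]
      conjugate_square_ge_0_vec[of a] conjugate_square_ge_0_vec[of b] ab
    by auto
  ultimately have "Im z = 0" by simp
  then have "S *\<^sub>v a = Re z \<cdot>\<^sub>v a" "S *\<^sub>v b = Re z \<cdot>\<^sub>v b"
    using ab by (auto simp: Sa Sb intro!: eq_vecI)
  with ne ab that show ?thesis by blast
qed

text \<open>
  Since \<open>S\<close> is symmetric, it maps the orthogonal complement of given eigenvectors into itself. An
  eigenvector of the compression \<open>Y\<^sup>T S Y\<close>, where the columns of \<open>Y\<close> are an orthonormal basis of the
  complement, therefore yields an eigenvector of \<open>S\<close> there.
\<close>
lemma ex_orthogonal_eigenvector: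
  fixes S :: "real mat"
  assumes S: "S \<in> carrier_mat N N" "S\<^sup>T = S" and "k < N"
    and v: "orthonormal N k v" and ev: "\<And>j. j < k \<Longrightarrow> S *\<^sub>v v j = l j \<cdot>\<^sub>v v j"
  obtains t x where "x \<in> carrier_vec N" "x \<bullet> x = 1" "S *\<^sub>v x = t \<cdot>\<^sub>v x" "\<And>j. j < k \<Longrightarrow> v j \<bullet> x = 0"
proof -
  obtain w where w: "orthonormal N N w" and wv: "\<And>i. i < k \<Longrightarrow> w i = v i"
    using orthonormal_extend[OF v] \<open>k < N\<close> by (metis less_imp_le)
  define Y where "Y = mat N (N - k) (\<lambda>(i, j). w (k + j) $ i)"
  have Y: "Y \<in> carrier_mat N (N - k)" by (simp add: Y_def)
  have colY: "col Y j = w (k + j)" if "j < N - k" for j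
    using that carrier_vecD[OF orthonormal_carrier[OF w, of "k + j"]]
    by (intro eq_vecI) (auto simp: Y_def)
  define T where "T = Y\<^sup>T * (S * Y)"
  have T: "T \<in> carrier_mat (N - k) (N - k)" using S Y by (simp add: T_def)
  have "T\<^sup>T = (S * Y)\<^sup>T * Y"
    unfolding T_def using transpose_mult[of "Y\<^sup>T" "N - k" N "S * Y" "N - k"] S Y by simp
  also have "\<dots> = T"
    unfolding T_def using transpose_mult[OF S(1) Y] S Y by (simp add: assoc_mult_mat[of _ "N - k" N _ N])
  finally have "T\<^sup>T = T" .
  moreover have "N - k > 0" using \<open>k < N\<close> by simp
  ultimately obtain t y
    where y: "y \<in> carrier_vec (N - k)" "y \<noteq> 0\<^sub>v (N - k)" "T *\<^sub>v y = t \<cdot>\<^sub>v y"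
    using real_symmetric_has_eigenvector[OF T] by blast
  define x where "x = Y *\<^sub>v y"
  have x: "x \<in> carrier_vec N" using Y y(1) by (simp add: x_def)
  have YY: "Y\<^sup>T * Y = 1\<^sub>m (N - k)"
  proof (rule eq_matI)
    fix a b assume "a < dim_row (1\<^sub>m (N - k) :: real mat)" "b < dim_col (1\<^sub>m (N - k) :: real mat)"
    then show "(Y\<^sup>T * Y) $$ (a, b) = 1\<^sub>m (N - k) $$ (a, b)"
      using Y by (simp add: colY orthonormal_scalar_prod[OF w])
  qed (use Y in auto)
  have YTx: "Y\<^sup>T *\<^sub>v x = y" unfolding x_def
    using Y y(1) YY assoc_mult_mat_vec[of "Y\<^sup>T" "N - k" N Y "N - k" y] by simp
  have YTS: "Y\<^sup>T *\<^sub>v (S *\<^sub>v x) = t \<cdot>\<^sub>v y"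
  proof -
    have "Y\<^sup>T *\<^sub>v (S *\<^sub>v x) = T *\<^sub>v y" unfolding x_def T_def
      using Y S(1) y(1) assoc_mult_mat_vec[of "Y\<^sup>T" "N - k" N "S * Y" "N - k" y]
        assoc_mult_mat_vec[OF S(1) Y y(1)] by simp
    then show ?thesis using y(3) by simp
  qed
  have proj: "(Y\<^sup>T *\<^sub>v u) $ j = w (k + j) \<bullet> u" if "j < N - k" for j u
    using that Y by (simp add: colY)
  have vx: "v j \<bullet> x = 0" if j: "j < k" for j
  proof -
    have "Y\<^sup>T *\<^sub>v v j = 0\<^sub>v (N - k)"
      using Y j \<open>k < N\<close> by (intro eq_vecI) (auto simp: colY wv[symmetric] orthonormal_scalar_prod[OF w])
    then show ?thesis
      using transpose_vec_mult_scalar[OF Y y(1) orthonormal_carrier[OF v j]] y(1)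
      by (simp add: x_def)
  qed
  have Sx: "S *\<^sub>v x = t \<cdot>\<^sub>v x"
  proof (rule orthonormal_eqI[OF w])
    fix r assume r: "r < N"
    show "w r \<bullet> (S *\<^sub>v x) = w r \<bullet> (t \<cdot>\<^sub>v x)"
    proof (cases "r < k")
      case True
      have "v r \<bullet> (S *\<^sub>v x) = (S *\<^sub>v v r) \<bullet> x"
        using symmetric_adjoint[OF S orthonormal_carrier[OF v True] x] by simp
      also have "\<dots> = 0" using vx[OF True] ev[OF True] x orthonormal_carrier[OF v True] by simp
      finally show ?thesis using vx[OF True] x orthonormal_carrier[OF v True] wv[OF True] by simp
    next
      case False
      then have "r = k + (r - k)" "r - k < N - k" using r by auto
      then show ?thesis
        using proj[of "r - k" "S *\<^sub>v x"] proj[of "r - k" x] YTx YTS y(1) x orthonormal_carrier[OF w r]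
        by simp
    qed
  qed (use S x in auto)
  have "x \<noteq> 0\<^sub>v N" using YTx y(2) Y by auto
  then have pos: "x \<bullet> x > 0" using conjugate_square_greater_0_vec[of x N] x by auto
  define c where "c = 1 / sqrt (x \<bullet> x)"
  show ?thesis
  proof (rule that)
    show "c \<cdot>\<^sub>v x \<in> carrier_vec N" using x by simp
    show "(c \<cdot>\<^sub>v x) \<bullet> (c \<cdot>\<^sub>v x) = 1" using x pos by (simp add: c_def)
    show "S *\<^sub>v (c \<cdot>\<^sub>v x) = t \<cdot>\<^sub>v (c \<cdot>\<^sub>v x)"
      using mult_mat_vec[OF S(1) x] Sx by (simp add: smult_smult_assoc mult.commute)
    show "v j \<bullet> (c \<cdot>\<^sub>v x) = 0" if "j < k" for j
      using vx[OF that] x orthonormal_carrier[OF v that] by simp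
  qed
qed

theorem spectral_theorem:
  fixes S :: "real mat"
  assumes S: "S \<in> carrier_mat N N" "S\<^sup>T = S"
  obtains v l where "eigenbasis N S v l" "antimono_on {..<N} l"
proof -
  have "\<exists>v l. orthonormal N k v \<and> (\<forall>j<k. S *\<^sub>v v j = l j \<cdot>\<^sub>v v j)" if "k \<le> N" for k
    using that
  proof (induction k)
    case 0
    then show ?case by (auto simp: orthonormal_def)
  next
    case (Suc k)
    then obtain v l where v: "orthonormal N k v" and ev: "\<And>j. j < k \<Longrightarrow> S *\<^sub>v v j = l j \<cdot>\<^sub>v v j"
      by auto
    obtain t x where x: "x \<in> carrier_vec N" "x \<bullet> x = 1" "S *\<^sub>v x = t \<cdot>\<^sub>v x"
        "\<And>j. j < k \<Longrightarrow> v j \<bullet> x = 0"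
      using ex_orthogonal_eigenvector[OF S _ v ev] Suc.prems by (metis Suc_le_eq)
    have "x \<bullet> v i = 0" if "i < k" for i
      using x(4)[OF that] comm_scalar_prod[OF x(1) orthonormal_carrier[OF v that]] by simp
    with x v have "orthonormal N (Suc k) (v(k := x))"
      by (auto simp: orthonormal_def less_Suc_eq)
    moreover have "\<forall>j<Suc k. S *\<^sub>v (v(k := x)) j = (l(k := t)) j \<cdot>\<^sub>v (v(k := x)) j"
      using ev x(3) by (auto simp: less_Suc_eq)
    ultimately show ?case by blast
  qed
  from this[of N] obtain v l where E: "eigenbasis N S v l" using S by (auto simp: eigenbasis_def)
  obtain p where p: "p permutes {..<N}" "antimono_on {..<N} (l \<circ> p)"
    by (rule sorting_permutation)
  from that[OF eigenbasis_permute[OF E p(1)] p(2)] show ?thesis .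
qed

section \<open>Perturbation of eigenvalues\<close>

text \<open>
  A unit vector \<open>x\<close> orthogonal to \<open>v'\<^sub>r\<close> for \<open>r < i\<close> and to \<open>v\<^sub>r\<close> for \<open>r > i\<close> satisfies only \<open>N - 1\<close>
  conditions, so it exists. For it, the form of \<open>S\<close> is at least \<open>l i\<close> and the form of \<open>S'\<close> is at
  most \<open>l' i\<close>.
\<close>
lemma weyl_monotonicity:
  assumes E: "eigenbasis N S v l" "antimono_on {..<N} l"
    and E': "eigenbasis N S' v' l'" "antimono_on {..<N} l'"
    and le: "\<And>x. x \<in> carrier_vec N \<Longrightarrow> x \<bullet> (S *\<^sub>v x) \<le> x \<bullet> (S' *\<^sub>v x) + t * (x \<bullet> x)"
    and i: "i < N"
  shows "l i \<le> l' i + t"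
proof -
  have v: "orthonormal N N v" and v': "orthonormal N N v'" using E(1) E'(1) by (auto simp: eigenbasis_def)
  (* Dropping v i from the second list leaves N - 1 vectors in total. *)
  define w where "w r = (if r < i then v' r else v (Suc r))" for r
  obtain x where x: "x \<in> carrier_vec N" "x \<bullet> x = 1" and wx: "\<And>r. r < N - 1 \<Longrightarrow> w r \<bullet> x = 0"
  proof (rule ex_unit_orthogonal_vec[of "N - 1" N w])
    show "w r \<in> carrier_vec N" if "r < N - 1" for r
      using that i orthonormal_carrier[OF v, of "Suc r"] orthonormal_carrier[OF v', of r]
      by (simp add: w_def)
  qed (use i in auto)
  have lower: "v' r \<bullet> x = 0" if "r < i" for r using wx[of r] that i by (simp add: w_def)
  have upper: "v r \<bullet> x = 0" if "i < r" "r < N" for r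
    using wx[of "r - 1"] that by (cases r) (simp_all add: w_def)
  have "l i = l i * (\<Sum>r<N. (v r \<bullet> x)\<^sup>2)"
    using parseval[OF v x(1,1)] x(2) by (simp add: power2_eq_square)
  also have "\<dots> \<le> (\<Sum>r<N. l r * (v r \<bullet> x)\<^sup>2)" unfolding sum_distrib_left
  proof (rule sum_mono)
    fix r assume r: "r \<in> {..<N}"
    show "l i * (v r \<bullet> x)\<^sup>2 \<le> l r * (v r \<bullet> x)\<^sup>2"
      using upper[of r] E(2) r i
      by (cases "i < r") (auto simp: monotone_on_def intro!: mult_right_mono)
  qed
  also have "\<dots> = x \<bullet> (S *\<^sub>v x)" using eigenbasis_quadratic_form[OF E(1) x(1)] by simp
  also have "\<dots> \<le> x \<bullet> (S' *\<^sub>v x) + t" using le[OF x(1)] x(2) by simp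
  also have "x \<bullet> (S' *\<^sub>v x) = (\<Sum>r<N. l' r * (v' r \<bullet> x)\<^sup>2)"
    using eigenbasis_quadratic_form[OF E'(1) x(1)] .
  also have "\<dots> \<le> l' i * (\<Sum>r<N. (v' r \<bullet> x)\<^sup>2)" unfolding sum_distrib_left
  proof (rule sum_mono)
    fix r assume r: "r \<in> {..<N}"
    show "l' r * (v' r \<bullet> x)\<^sup>2 \<le> l' i * (v' r \<bullet> x)\<^sup>2"
      using lower[of r] E'(2) r i
      by (cases "r < i") (auto simp: monotone_on_def intro!: mult_right_mono)
  qed
  also have "\<dots> = l' i" using parseval[OF v' x(1,1)] x(2) by (simp add: power2_eq_square)
  finally show ?thesis by simp
qed

text \<open>
  Let \<open>k = card I\<close> and let \<open>t\<close> be the \<open>k\<close>-th largest eigenvalue of \<open>C\<close>. The positive part \<open>P\<close> of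
  \<open>C - t\<close> satisfies \<open>0 \<le> P\<close> and \<open>C \<le> P + t\<close>. Monotonicity bounds each \<open>l' i\<close> by \<open>e i + t\<close>, where
  \<open>e\<close> are the eigenvalues of \<open>S + P\<close>, and shows \<open>l \<le> e\<close> everywhere. The sum of \<open>e i - l i\<close> over \<open>I\<close> can
  therefore be enlarged to the sum over all indices, which is the trace of \<open>P\<close>.
\<close>
theorem lidskii:
  assumes E: "eigenbasis N S v l" "antimono_on {..<N} l"
    and E': "eigenbasis N (S + C) v' l'" "antimono_on {..<N} l'"
    and C: "eigenbasis N C w c" "antimono_on {..<N} c"
    and I: "I \<subseteq> {..<N}"
  shows "(\<Sum>i\<in>I. l' i - l i) \<le> (\<Sum>i<card I. c i)"
proof (cases "I = {}")
  case True
  then show ?thesis by simp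
next
  case False
  have fin: "finite I" using I finite_subset by blast
  define k where "k = card I"
  have k: "0 < k" "k \<le> N"
    using False fin card_mono[OF _ I] by (auto simp: k_def card_gt_0_iff)
  define t where "t = c (k - 1)"
  have S: "S \<in> carrier_mat N N" and Cc: "C \<in> carrier_mat N N" and w: "orthonormal N N w"
    using E(1) C(1) by (auto simp: eigenbasis_def)
  obtain P where P: "eigenbasis N P w (\<lambda>r. max (c r - t) 0)"
    using ex_matrix_with_eigenbasis[OF w] .
  have Pc: "P \<in> carrier_mat N N" using P by (simp add: eigenbasis_def)
  have "(S + P)\<^sup>T = S + P"
    using transpose_add[OF S Pc] eigenbasis_symmetric[OF E(1)] eigenbasis_symmetric[OF P] by simp
  then obtain y e where T: "eigenbasis N (S + P) y e" "antimono_on {..<N} e"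
    using spectral_theorem[of "S + P" N] S Pc by auto
  have split: "x \<bullet> ((S + M) *\<^sub>v x) = x \<bullet> (S *\<^sub>v x) + x \<bullet> (M *\<^sub>v x)"
    if "x \<in> carrier_vec N" "M \<in> carrier_mat N N" for x M
    using that S by (simp add: add_mult_distrib_mat_vec[of _ N N] scalar_prod_add_distrib[of _ N])
  have le_e: "l i \<le> e i" if "i < N" for i
  proof -
    have "x \<bullet> (S *\<^sub>v x) \<le> x \<bullet> ((S + P) *\<^sub>v x) + 0 * (x \<bullet> x)" if x: "x \<in> carrier_vec N" for x
      using split[OF x Pc] eigenbasis_quadratic_form[OF P x] by (simp add: sum_nonneg)
    from weyl_monotonicity[OF E T this that] show ?thesis by simp
  qed
  have e_le: "l' i \<le> e i + t" if "i < N" for i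
  proof -
    have "x \<bullet> ((S + C) *\<^sub>v x) \<le> x \<bullet> ((S + P) *\<^sub>v x) + t * (x \<bullet> x)" if x: "x \<in> carrier_vec N" for x
    proof -
      have "x \<bullet> (C *\<^sub>v x) = (\<Sum>r<N. c r * (w r \<bullet> x)\<^sup>2)"
        using eigenbasis_quadratic_form[OF C(1) x] .
      also have "\<dots> \<le> (\<Sum>r<N. max (c r - t) 0 * (w r \<bullet> x)\<^sup>2 + t * (w r \<bullet> x)\<^sup>2)"
        unfolding distrib_right[symmetric] by (intro sum_mono mult_right_mono) auto
      also have "\<dots> = x \<bullet> (P *\<^sub>v x) + t * (x \<bullet> x)"
        using eigenbasis_quadratic_form[OF P x] parseval[OF w x x]
        by (simp add: sum.distrib sum_distrib_left power2_eq_square)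
      finally show ?thesis using split[OF x Pc] split[OF x Cc] by simp
    qed
    from weyl_monotonicity[OF E' T this that] show ?thesis .
  qed
  have tr: "(\<Sum>i<N. e i) = (\<Sum>i<N. l i) + (\<Sum>i<N. max (c i - t) 0)"
  proof -
    have "(\<Sum>i<N. (S + P) $$ (i, i)) = (\<Sum>i<N. S $$ (i, i)) + (\<Sum>i<N. P $$ (i, i))"
      using S Pc by (simp add: sum.distrib)
    then show ?thesis
      by (simp add: eigenbasis_trace[OF T(1)] eigenbasis_trace[OF E(1)] eigenbasis_trace[OF P])
  qed
  have "(\<Sum>i\<in>I. l' i - l i) \<le> (\<Sum>i\<in>I. (e i - l i) + t)"
    using e_le I by (intro sum_mono) (auto simp: algebra_simps)
  also have "\<dots> = (\<Sum>i\<in>I. e i - l i) + k * t" by (simp add: sum.distrib k_def)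
  also have "(\<Sum>i\<in>I. e i - l i) \<le> (\<Sum>i<N. e i - l i)"
    using I le_e by (intro sum_mono2) auto
  also have "\<dots> = (\<Sum>i<N. max (c i - t) 0)" using tr by (simp add: sum_subtractf)
  (* As c decreases and c (k - 1) = t, the positive part keeps exactly the first k terms. *)
  also have "\<dots> = (\<Sum>i<k. c i - t)"
  proof -
    have "{..<N} = {..<k} \<union> {k..<N}" "{..<k} \<inter> {k..<N} = {}" using k by auto
    moreover have "(\<Sum>i<k. max (c i - t) 0) = (\<Sum>i<k. c i - t)"
      using C(2) k by (intro sum.cong) (auto simp: t_def monotone_on_def)
    moreover have "(\<Sum>i\<in>{k..<N}. max (c i - t) 0) = 0"
      using C(2) k by (intro sum.neutral) (auto simp: t_def monotone_on_def)
    ultimately show ?thesis by (simp add: sum.union_disjoint)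
  qed
  also have "\<dots> + k * t = (\<Sum>i<k. c i)" by (simp add: sum_subtractf)
  finally show ?thesis by (simp add: k_def)
qed

section \<open>Singular values\<close>

lemma Diag_carrier [simp]: "Diag m n x \<in> carrier_mat m n"
  by (simp add: Diag_def)

lemma proots_linear_factors:
  "proots (\<Prod>a\<leftarrow>as. [:- a, 1:]) = mset (as :: real list)"
proof (induction as)
  case (Cons a as)
  have "(\<Prod>a\<leftarrow>as. [:- a, 1:]) \<noteq> (0 :: real poly)" by (auto simp: prod_list_zero_iff)
  then show ?case using Cons by (simp add: proots_mult del: mult_pCons_left)
qed simp

lemma eigenbasis_diagonalization:
  assumes E: "eigenbasis N S v l"
  shows "S = cols_mat N v * Diag N N (vec N l) * (cols_mat N v)\<^sup>T"
proof (rule eq_matI)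
  have "S \<in> carrier_mat N N" using E by (simp add: eigenbasis_def)
  then show "dim_row S = dim_row (cols_mat N v * Diag N N (vec N l) * (cols_mat N v)\<^sup>T)"
    and "dim_col S = dim_col (cols_mat N v * Diag N N (vec N l) * (cols_mat N v)\<^sup>T)"
    by (simp_all add: cols_mat_def)
next
  fix i j
  assume "i < dim_row (cols_mat N v * Diag N N (vec N l) * (cols_mat N v)\<^sup>T)"
    and "j < dim_col (cols_mat N v * Diag N N (vec N l) * (cols_mat N v)\<^sup>T)"
  then have ij: "i < N" "j < N" by (simp_all add: cols_mat_def)
  have "(cols_mat N v * Diag N N (vec N l)) $$ (i, r) = l r * v r $ i" if "r < N" for r
    using that ij by (simp add: cols_mat_def Diag_def scalar_prod_def if_distrib mult.commute cong: if_cong)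
  then show "S $$ (i, j) = (cols_mat N v * Diag N N (vec N l) * (cols_mat N v)\<^sup>T) $$ (i, j)"
    using ij by (simp add: eigenbasis_entries[OF E] scalar_prod_def cols_mat_def atLeast0LessThan Diag_def)
qed

lemma eigenbasis_proots_char_poly:
  assumes E: "eigenbasis N S v l"
  shows "proots (char_poly S) = mset (map l [0..<N])"
proof -
  define Q where "Q = cols_mat N v"
  define D where "D = Diag N N (vec N l)"
  have Q: "Q * Q\<^sup>T = 1\<^sub>m N" "Q\<^sup>T * Q = 1\<^sub>m N" "Q \<in> carrier_mat N N"
    using orthonormal_cols_mat[of N v] E by (auto simp: orthogonal_matrix_def Q_def eigenbasis_def)
  have S: "S \<in> carrier_mat N N" using E by (simp add: eigenbasis_def)
  have D: "D \<in> carrier_mat N N" by (simp add: D_def)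
  have "similar_mat_wit S D Q Q\<^sup>T"
    by (rule similar_mat_witI[of _ _ N])
      (use Q S D eigenbasis_diagonalization[OF E] in \<open>auto simp: Q_def D_def\<close>)
  then have "char_poly S = char_poly D" by (intro char_poly_similar) (auto simp: similar_mat_def)
  also have "\<dots> = (\<Prod>a\<leftarrow>diag_mat D. [:- a, 1:])"
    by (rule char_poly_upper_triangular[OF D]) (auto simp: D_def Diag_def)
  also have "diag_mat D = map l [0..<N]" by (auto simp: diag_mat_def D_def Diag_def)
  finally show ?thesis by (simp only: proots_linear_factors)
qed

lemma singular_values_eq_sqrt_eigenvalues:
  assumes X: "X \<in> carrier_mat m n" and E: "eigenbasis n (X\<^sup>T * X) v d"
    and d: "antimono_on {..<n} d" and i: "i < min m n"
  shows "singular_values X $ i = sqrt (d i)"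
proof -
  have "rev (sorted_list_of_multiset (proots (char_poly (X\<^sup>T * X)))) = map d [0..<n]"
    using rev_sort_eq_map[OF d refl]
    by (simp only: eigenbasis_proots_char_poly[OF E] sorted_list_of_multiset_mset)
  then show ?thesis using X i by (simp add: singular_values_def)
qed

lemma singular_values_carrier:
  "X \<in> carrier_mat m n \<Longrightarrow> singular_values X \<in> carrier_vec (min m n)"
  by (auto simp: singular_values_def)

text \<open>
  The relations \<open>X v\<^sub>j = s\<^sub>j u\<^sub>j\<close> and \<open>X\<^sup>T u\<^sub>j = s\<^sub>j v\<^sub>j\<close>, with the bases of the two spaces having different
  sizes. The numbers \<open>s\<^sub>j\<close> are left unsorted and of any sign, so that \<open>U Diag(z) V\<^sup>T\<close> fits for
  arbitrary \<open>z\<close>.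
\<close>
definition singular_system ::
  "nat \<Rightarrow> nat \<Rightarrow> real mat \<Rightarrow> (nat \<Rightarrow> real vec) \<Rightarrow> (nat \<Rightarrow> real vec) \<Rightarrow> (nat \<Rightarrow> real) \<Rightarrow> bool" where
  "singular_system m n X u v s \<longleftrightarrow>
     X \<in> carrier_mat m n \<and> orthonormal m m u \<and> orthonormal n n v \<and>
     (\<forall>j<n. X *\<^sub>v v j = (if j < m then s j \<cdot>\<^sub>v u j else 0\<^sub>v m)) \<and>
     (\<forall>j<m. X\<^sup>T *\<^sub>v u j = (if j < n then s j \<cdot>\<^sub>v v j else 0\<^sub>v n))"

text \<open>
  For an orthonormal eigenbasis \<open>v\<close> of \<open>X\<^sup>T X\<close>, the vectors \<open>X v\<^sub>j\<close> are pairwise orthogonal, with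
  squared lengths equal to the eigenvalues. Those that do not vanish are normalized and completed
  to the basis \<open>u\<close>.
\<close>
theorem singular_value_decomposition:
  assumes X: "X \<in> carrier_mat m n"
  obtains u v where "singular_system m n X u v (\<lambda>i. singular_values X $ i)"
    and "singular_values X \<in> nonneg_decreasing_vecs (min m n)"
proof -
  have XX: "X\<^sup>T * X \<in> carrier_mat n n" "(X\<^sup>T * X)\<^sup>T = X\<^sup>T * X"
    using X transpose_mult[of "X\<^sup>T" n m X n] by auto
  obtain v d where E: "eigenbasis n (X\<^sup>T * X) v d" and d: "antimono_on {..<n} d"
    using spectral_theorem[OF XX] .
  have v: "orthonormal n n v" using E by (simp add: eigenbasis_def)
  note vc = orthonormal_carrier[OF v]
  have gram: "(X *\<^sub>v v i) \<bullet> (X *\<^sub>v v j) = (if i = j then d j else 0)" if "i < n" "j < n" for i j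
  proof -
    have "(X *\<^sub>v v i) \<bullet> (X *\<^sub>v v j) = v i \<bullet> (X\<^sup>T *\<^sub>v (X *\<^sub>v v j))"
      using transpose_vec_mult_scalar[of "X\<^sup>T" n m "X *\<^sub>v v j" "v i"] X vc[OF that(1)] vc[OF that(2)]
      by simp
    also have "X\<^sup>T *\<^sub>v (X *\<^sub>v v j) = X\<^sup>T * X *\<^sub>v v j"
      using X vc[OF that(2)] by simp
    also have "\<dots> = d j \<cdot>\<^sub>v v j" using E that(2) by (simp add: eigenbasis_def)
    finally show ?thesis
      using orthonormal_scalar_prod[OF v that] vc[OF that(1)] vc[OF that(2)] by simp
  qed
  have d_nonneg: "d j \<ge> 0" if "j < n" for j
    using gram[OF that that] conjugate_square_ge_0_vec[of "X *\<^sub>v v j"] by simp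
  (* r is the rank of X; it is n if no eigenvalue vanishes. *)
  define r where "r = (LEAST j. j = n \<or> d j = 0)"
  have r: "r = n \<or> d r = 0"
    unfolding r_def by (rule LeastI[of "\<lambda>j. j = n \<or> d j = 0" n]) simp
  have rn: "r \<le> n" unfolding r_def by (rule Least_le) simp
  have d_pos: "d j > 0" if "j < r" for j
  proof -
    have "d j \<noteq> 0" using not_less_Least[of j "\<lambda>j. j = n \<or> d j = 0"] that by (simp add: r_def)
    then show ?thesis using d_nonneg[of j] that rn by simp
  qed
  have d_zero: "d j = 0" if "r \<le> j" "j < n" for j
  proof -
    have "d r = 0" using r that by auto
    moreover have "d j \<le> d r" using d that by (auto simp: monotone_on_def)
    ultimately show ?thesis using d_nonneg[OF that(2)] by simp
  qed
  define u0 where "u0 j = (1 / sqrt (d j)) \<cdot>\<^sub>v (X *\<^sub>v v j)" for j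
  have u0: "orthonormal m r u0"
    unfolding orthonormal_def
  proof (intro conjI allI impI)
    fix i assume i: "i < r"
    then show "u0 i \<in> carrier_vec m" using X vc[of i] rn by (simp add: u0_def)
    fix j assume j: "j < r"
    have c: "X *\<^sub>v v i \<in> carrier_vec m" "X *\<^sub>v v j \<in> carrier_vec m"
      using X vc[of i] vc[of j] i j rn by auto
    show "u0 i \<bullet> u0 j = (if i = j then 1 else 0)"
      using gram[of i j] i j rn d_pos[OF j] c by (simp add: u0_def)
  qed
  have rm: "r \<le> m" using orthonormal_card_le[OF u0] .
  obtain u where u: "orthonormal m m u" and uu0: "\<And>j. j < r \<Longrightarrow> u j = u0 j"
    using orthonormal_extend[OF u0 rm] by blast
  note uc = orthonormal_carrier[OF u]
  have sv: "singular_values X $ j = sqrt (d j)" if "j < n" "j < m" for j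
    using singular_values_eq_sqrt_eigenvalues[OF X E d] that by simp
  have Xv: "X *\<^sub>v v j = (if j < m then singular_values X $ j \<cdot>\<^sub>v u j else 0\<^sub>v m)" if j: "j < n" for j
  proof (cases "j < r")
    case True
    then show ?thesis using sv[OF j] d_pos[OF True] rm
      by (simp add: uu0 u0_def smult_smult_assoc)
  next
    case False
    have c: "X *\<^sub>v v j \<in> carrier_vec m" using X vc[OF j] by simp
    have "X *\<^sub>v v j = 0\<^sub>v m"
      using gram[OF j j] d_zero[OF _ j] False conjugate_square_eq_0_vec[OF c] by simp
    then show ?thesis using sv[OF j] d_zero[OF _ j] False uc[of j]
      by (auto intro!: eq_vecI)
  qed
  have Xu: "X\<^sup>T *\<^sub>v u j = (if j < n then singular_values X $ j \<cdot>\<^sub>v v j else 0\<^sub>v n)" if j: "j < m" for j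
  proof (rule orthonormal_eqI[OF v])
    fix i assume i: "i < n"
    have "v i \<bullet> (X\<^sup>T *\<^sub>v u j) = (X *\<^sub>v v i) \<bullet> u j"
      using transpose_vec_mult_scalar[of "X\<^sup>T" n m "u j" "v i"] X vc[OF i] uc[OF j] by simp
    also have "\<dots> = (if i = j then singular_values X $ j else 0)"
      using Xv[OF i] j uc[OF j] uc[of i] orthonormal_scalar_prod[OF u _ j, of i] by auto
    finally show "v i \<bullet> (X\<^sup>T *\<^sub>v u j) = v i \<bullet> (if j < n then singular_values X $ j \<cdot>\<^sub>v v j else 0\<^sub>v n)"
      using orthonormal_scalar_prod[OF v i, of j] vc[OF i] vc[of j] i by auto
  qed (use X uc[OF j] vc[of j] in auto)
  have "singular_values X \<in> nonneg_decreasing_vecs (min m n)"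
    using singular_values_carrier[OF X] d d_nonneg
    by (auto simp: nonneg_decreasing_vecs_def sv monotone_on_def)
  moreover have "singular_system m n X u v (\<lambda>i. singular_values X $ i)"
    using X u v Xv Xu by (simp add: singular_system_def)
  ultimately show ?thesis using that by blast
qed

section \<open>The symmetric dilation and Mirsky's inequality\<close>

definition dilation :: "real mat \<Rightarrow> real mat" where
  "dilation X = four_block_mat (0\<^sub>m (dim_row X) (dim_row X)) X X\<^sup>T (0\<^sub>m (dim_col X) (dim_col X))"

lemma dilation_add:
  assumes "X \<in> carrier_mat m n" "Y \<in> carrier_mat m n"
  shows "dilation (X + Y) = dilation X + dilation Y"
  using assms add_four_block_mat[of "0\<^sub>m m m" m m X n "X\<^sup>T" n "0\<^sub>m n n" "0\<^sub>m m m" Y "Y\<^sup>T" "0\<^sub>m n n"]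
    transpose_add[OF assms]
  by (simp add: dilation_def)

text \<open>
  The \<open>i\<close>-th vectors of two bases of different sizes, scaled and written one below the other. A
  block for which \<open>i\<close> is out of range is zero; so for \<open>min m n \<le> i < max m n\<close> the vector \<open>stack m n u v 1 1 i\<close> is a
  single basis vector padded with zeros.
\<close>
definition stack ::
  "nat \<Rightarrow> nat \<Rightarrow> (nat \<Rightarrow> real vec) \<Rightarrow> (nat \<Rightarrow> real vec) \<Rightarrow> real \<Rightarrow> real \<Rightarrow> nat \<Rightarrow> real vec" where
  "stack m n u v a b i =
     (if i < m then a \<cdot>\<^sub>v u i else 0\<^sub>v m) @\<^sub>v (if i < n then b \<cdot>\<^sub>v v i else 0\<^sub>v n)"

lemma stack_smult: "c \<cdot>\<^sub>v stack m n u v a b i = stack m n u v (c * a) (c * b) i"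
  by (intro eq_vecI) (auto simp: stack_def)

lemma stack_scalar_prod:
  assumes u: "orthonormal m m u" and v: "orthonormal n n v"
  shows "stack m n u v a b i \<bullet> stack m n u v a' b' j =
    (if i = j then (if i < m then a * a' else 0) + (if i < n then b * b' else 0) else 0)"
proof -
  have "stack m n u v a b i \<bullet> stack m n u v a' b' j =
      (if i < m then a \<cdot>\<^sub>v u i else 0\<^sub>v m) \<bullet> (if j < m then a' \<cdot>\<^sub>v u j else 0\<^sub>v m) +
      (if i < n then b \<cdot>\<^sub>v v i else 0\<^sub>v n) \<bullet> (if j < n then b' \<cdot>\<^sub>v v j else 0\<^sub>v n)"
    unfolding stack_def
    by (rule scalar_prod_append[of _ m _ n])
      (use orthonormal_carrier[OF u] orthonormal_carrier[OF v] in auto)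
  also have "(if i < m then a \<cdot>\<^sub>v u i else 0\<^sub>v m) \<bullet> (if j < m then a' \<cdot>\<^sub>v u j else 0\<^sub>v m) =
      (if i = j \<and> i < m then a * a' else 0)"
    using orthonormal_carrier[OF u, of i] orthonormal_carrier[OF u, of j]
      orthonormal_scalar_prod[OF u, of i j] by auto
  also have "(if i < n then b \<cdot>\<^sub>v v i else 0\<^sub>v n) \<bullet> (if j < n then b' \<cdot>\<^sub>v v j else 0\<^sub>v n) =
      (if i = j \<and> i < n then b * b' else 0)"
    using orthonormal_carrier[OF v, of i] orthonormal_carrier[OF v, of j]
      orthonormal_scalar_prod[OF v, of i j] by auto
  finally show ?thesis by auto
qed

text \<open>
  The dilation swaps the two scalars and multiplies by \<open>s i\<close>. Hence equal scalars give an eigenvector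
  for \<open>s i\<close>, and opposite scalars one for \<open>- s i\<close>.
\<close>
lemma dilation_stack:
  assumes "singular_system m n X u v s"
  shows "dilation X *\<^sub>v stack m n u v a b i =
    (if i < min m n then s i \<cdot>\<^sub>v stack m n u v b a i else 0\<^sub>v (m + n))"
proof -
  have X: "X \<in> carrier_mat m n" and u: "orthonormal m m u" and v: "orthonormal n n v"
    using assms by (auto simp: singular_system_def)
  define y where "y = (if i < m then a \<cdot>\<^sub>v u i else 0\<^sub>v m)"
  define z where "z = (if i < n then b \<cdot>\<^sub>v v i else 0\<^sub>v n)"
  have y: "y \<in> carrier_vec m" and z: "z \<in> carrier_vec n"
    using orthonormal_carrier[OF u] orthonormal_carrier[OF v] by (auto simp: y_def z_def)
  have "dilation X *\<^sub>v stack m n u v a b i =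
      (0\<^sub>m m m *\<^sub>v y + X *\<^sub>v z) @\<^sub>v (X\<^sup>T *\<^sub>v y + 0\<^sub>m n n *\<^sub>v z)"
    using four_block_mat_mult_vec[of "0\<^sub>m m m" m m X n "X\<^sup>T" n "0\<^sub>m n n" y z] X y z
    by (simp add: dilation_def stack_def y_def z_def)
  also have "0\<^sub>m m m *\<^sub>v y = 0\<^sub>v m" using y by (intro eq_vecI) auto
  also have "0\<^sub>m n n *\<^sub>v z = 0\<^sub>v n" using z by (intro eq_vecI) auto
  also have "0\<^sub>v m + X *\<^sub>v z = X *\<^sub>v z" using mult_mat_vec_carrier[OF X z] by simp
  also have "X\<^sup>T *\<^sub>v y + 0\<^sub>v n = X\<^sup>T *\<^sub>v y"
    using mult_mat_vec_carrier[of "X\<^sup>T" n m y] X y by simp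
  also have "X *\<^sub>v z = (if i < min m n then (s i * b) \<cdot>\<^sub>v u i else 0\<^sub>v m)"
    using assms X orthonormal_carrier[OF v, of i] mult_mat_vec[OF X, of "v i" b]
    by (auto simp: z_def singular_system_def smult_smult_assoc mult.commute)
  also have "X\<^sup>T *\<^sub>v y = (if i < min m n then (s i * a) \<cdot>\<^sub>v v i else 0\<^sub>v n)"
    using assms X orthonormal_carrier[OF u, of i] mult_mat_vec[of "X\<^sup>T" n m "u i" a]
    by (auto simp: y_def singular_system_def smult_smult_assoc mult.commute)
  finally show ?thesis
    using orthonormal_carrier[OF u, of i] orthonormal_carrier[OF v, of i]
    by (auto simp: stack_def intro!: eq_vecI)
qed

text \<open>
  The eigenvectors are arranged so that their eigenvalues decrease if \<open>s\<close> decreases and is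
  nonnegative: the \<open>s i\<close> come first, then the zeros, then the \<open>- s i\<close> in reverse order, with
  \<open>- s i\<close> at position \<open>m + n - 1 - i\<close>.
\<close>
definition dilation_eigenvec ::
  "nat \<Rightarrow> nat \<Rightarrow> (nat \<Rightarrow> real vec) \<Rightarrow> (nat \<Rightarrow> real vec) \<Rightarrow> nat \<Rightarrow> real vec" where
  "dilation_eigenvec m n u v j =
     (if j < min m n then stack m n u v (1 / sqrt 2) (1 / sqrt 2) j
      else if j < max m n then stack m n u v 1 1 j
      else stack m n u v (1 / sqrt 2) (- 1 / sqrt 2) (m + n - 1 - j))"

definition dilation_eigenvalue :: "nat \<Rightarrow> nat \<Rightarrow> (nat \<Rightarrow> real) \<Rightarrow> nat \<Rightarrow> real" where
  "dilation_eigenvalue m n s j =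
     (if j < min m n then s j else if j < max m n then 0 else - s (m + n - 1 - j))"

lemma dilation_eigenbasis:
  assumes "singular_system m n X u v s"
  shows "eigenbasis (m + n) (dilation X) (dilation_eigenvec m n u v) (dilation_eigenvalue m n s)"
proof -
  have X: "X \<in> carrier_mat m n" and u: "orthonormal m m u" and v: "orthonormal n n v"
    using assms by (auto simp: singular_system_def)
  have c: "stack m n u v a b i \<in> carrier_vec (m + n)" for a b i
    using orthonormal_carrier[OF u, of i] orthonormal_carrier[OF v, of i] by (auto simp: stack_def)
  have o: "orthonormal (m + n) (m + n) (dilation_eigenvec m n u v)"
    unfolding orthonormal_def
  proof (intro conjI allI impI)
    fix i j assume "i < m + n" "j < m + n"
    then show "dilation_eigenvec m n u v i \<bullet> dilation_eigenvec m n u v j = (if i = j then 1 else 0)"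
      by (auto simp: dilation_eigenvec_def stack_scalar_prod[OF u v])
  qed (simp add: dilation_eigenvec_def c)
  have "dilation X *\<^sub>v dilation_eigenvec m n u v j =
      dilation_eigenvalue m n s j \<cdot>\<^sub>v dilation_eigenvec m n u v j" if j: "j < m + n" for j
  proof -
    consider "j < min m n" | "\<not> j < min m n" "j < max m n"
      | "\<not> j < min m n" "\<not> j < max m n" "m + n - 1 - j < min m n"
    proof -
      have "m + n - 1 - j < min m n" if "\<not> j < max m n" using that j by auto
      then show ?thesis using that by blast
    qed
    then show ?thesis
    proof cases
      case 2
      moreover have "0\<^sub>v (m + n) = 0 \<cdot>\<^sub>v stack m n u v 1 1 j"
        using c[of 1 1 j] by (intro eq_vecI) auto
      ultimately show ?thesis
        by (simp only: dilation_eigenvec_def dilation_eigenvalue_def dilation_stack[OF assms]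
            if_True if_False)
    qed (simp_all only: dilation_eigenvec_def dilation_eigenvalue_def dilation_stack[OF assms]
        stack_smult if_True if_False, simp_all)
  qed
  then show ?thesis using X o by (simp add: eigenbasis_def dilation_def)
qed

lemma dilation_eigenvalue_antimono:
  assumes "x \<in> nonneg_decreasing_vecs (min m n)"
  shows "antimono_on {..<m + n} (dilation_eigenvalue m n (\<lambda>i. x $ i))"
proof (rule monotone_onI)
  fix i j assume ij: "i \<in> {..<m + n}" "j \<in> {..<m + n}" "i \<le> j"
  have nonneg: "x $ k \<ge> 0" if "k < min m n" for k
    using assms that unfolding nonneg_decreasing_vecs_def by blast
  have anti: "x $ k' \<le> x $ k" if "k \<le> k'" "k' < min m n" for k k'
    using assms that unfolding nonneg_decreasing_vecs_def by blast
  have refl: "m + n - 1 - k < min m n" if "\<not> k < max m n" "k < m + n" for k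
    using that by auto
  have up: "j < min m n \<Longrightarrow> i < min m n" "j < max m n \<Longrightarrow> i < max m n" "i < min m n \<Longrightarrow> i < max m n"
    using ij(3) by (auto simp: less_max_iff_disj)
  consider "j < min m n" "i < min m n" | "i < min m n" "\<not> j < min m n" "j < max m n"
    | "i < min m n" "\<not> j < min m n" "\<not> j < max m n"
    | "\<not> i < min m n" "i < max m n" "\<not> j < min m n" "j < max m n"
    | "\<not> i < min m n" "i < max m n" "\<not> j < min m n" "\<not> j < max m n"
    | "\<not> i < min m n" "\<not> i < max m n" "\<not> j < min m n" "\<not> j < max m n"
    using up by blast
  then show "dilation_eigenvalue m n (\<lambda>i. x $ i) j \<le> dilation_eigenvalue m n (\<lambda>i. x $ i) i"
  proof cases
    case 1
    then show ?thesis using anti[OF ij(3)] by (simp only: dilation_eigenvalue_def if_True)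
  next
    case 2
    then show ?thesis using nonneg[of i] by (simp only: dilation_eigenvalue_def if_True if_False)
  next
    case 3
    moreover have "- x $ (m + n - 1 - j) \<le> x $ i"
      using nonneg[OF refl, of j] nonneg[of i] 3 ij(2) by simp
    ultimately show ?thesis by (simp only: dilation_eigenvalue_def if_True if_False)
  next
    case 4
    then show ?thesis by (simp only: dilation_eigenvalue_def if_True if_False)
  next
    case 5
    moreover have "- x $ (m + n - 1 - j) \<le> 0" using nonneg[OF refl, of j] 5 ij(2) by simp
    ultimately show ?thesis by (simp only: dilation_eigenvalue_def if_True if_False)
  next
    case 6
    moreover have "- x $ (m + n - 1 - j) \<le> - x $ (m + n - 1 - i)"
      using anti[OF _ refl, of "m + n - 1 - j" i] 6 ij by simp
    ultimately show ?thesis by (simp only: dilation_eigenvalue_def if_True if_False)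
  qed
qed

text \<open>
  Apply the Lidskii inequality to the dilations. For an index in \<open>K\<close> where \<open>\<sigma>\<^sub>i(X) \<ge> \<sigma>\<^sub>i(A)\<close> take
  the eigenvalue at position \<open>i\<close>, for the others the negated one at the mirrored position
  \<open>m + n - 1 - i\<close>. The two kinds of position do not overlap, so exactly \<open>card K\<close> are chosen.
\<close>
theorem mirsky:
  assumes X: "X \<in> carrier_mat m n" and A: "A \<in> carrier_mat m n" and K: "K \<subseteq> {..<min m n}"
  shows "(\<Sum>i\<in>K. \<bar>singular_values X $ i - singular_values A $ i\<bar>) \<le>
    (\<Sum>i<card K. singular_values (X - A) $ i)"
proof -
  define q where "q = min m n"
  have Z: "X - A \<in> carrier_mat m n" using A by (rule minus_carrier_mat)
  define l where "l Y = dilation_eigenvalue m n (\<lambda>i. singular_values Y $ i)" for Y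
  have ev: "\<exists>w. eigenbasis (m + n) (dilation Y) w (l Y) \<and> antimono_on {..<m + n} (l Y)"
    if Y: "Y \<in> carrier_mat m n" for Y
    using singular_value_decomposition[OF Y] dilation_eigenbasis dilation_eigenvalue_antimono
    unfolding l_def by metis
  from ev[OF X] ev[OF A] ev[OF Z] obtain wX wA wZ
    where E: "eigenbasis (m + n) (dilation X) wX (l X)" "antimono_on {..<m + n} (l X)"
      "eigenbasis (m + n) (dilation A) wA (l A)" "antimono_on {..<m + n} (l A)"
      "eigenbasis (m + n) (dilation (X - A)) wZ (l (X - A))" "antimono_on {..<m + n} (l (X - A))"
    by blast
  have "A + (X - A) = X" using X A by (intro eq_matI) auto
  then have dil: "dilation X = dilation A + dilation (X - A)" using dilation_add[OF A Z] by simp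
  define K1 where "K1 = {i \<in> K. singular_values A $ i \<le> singular_values X $ i}"
  define K2 where "K2 = K - K1"
  have K12: "K = K1 \<union> K2" "K1 \<inter> K2 = {}" "finite K1" "finite K2" "K1 \<subseteq> {..<q}" "K2 \<subseteq> {..<q}"
    using K finite_subset[OF K] by (auto simp: K1_def K2_def q_def)
  define \<rho> where "\<rho> i = m + n - 1 - i" for i
  have inj: "inj_on \<rho> K2"
  proof (rule inj_onI)
    fix i j assume "i \<in> K2" "j \<in> K2" "\<rho> i = \<rho> j"
    moreover from this have "i < m" "j < m" using K12(6) by (auto simp: q_def)
    ultimately show "i = j" by (simp add: \<rho>_def)
  qed
  have disj: "K1 \<inter> \<rho> ` K2 = {}" using K12(5,6) by (fastforce simp: \<rho>_def q_def)
  have card: "card (K1 \<union> \<rho> ` K2) = card K"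
    using K12 disj by (simp add: card_Un_disjoint card_image[OF inj])
  have l\<rho>: "l Y (\<rho> i) = - singular_values Y $ i" if "i < q" for Y i
  proof -
    have "\<not> \<rho> i < min m n" "\<not> \<rho> i < max m n" "m + n - 1 - \<rho> i = i"
      using that by (auto simp: \<rho>_def q_def)
    then show ?thesis by (simp only: l_def dilation_eigenvalue_def if_False)
  qed
  have "(\<Sum>i\<in>K. \<bar>singular_values X $ i - singular_values A $ i\<bar>) =
      (\<Sum>i\<in>K1. l X i - l A i) + (\<Sum>i\<in>K2. l X (\<rho> i) - l A (\<rho> i))"
  proof -
    have "(\<Sum>i\<in>K1. \<bar>singular_values X $ i - singular_values A $ i\<bar>) = (\<Sum>i\<in>K1. l X i - l A i)"
      using K12(5) by (intro sum.cong) (auto simp: l_def dilation_eigenvalue_def K1_def q_def)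
    moreover have "(\<Sum>i\<in>K2. \<bar>singular_values X $ i - singular_values A $ i\<bar>) =
        (\<Sum>i\<in>K2. l X (\<rho> i) - l A (\<rho> i))"
    proof (rule sum.cong)
      fix i assume i: "i \<in> K2"
      then have "i < q" using K12(6) by auto
      with i show "\<bar>singular_values X $ i - singular_values A $ i\<bar> = l X (\<rho> i) - l A (\<rho> i)"
        by (auto simp: l\<rho> K1_def K2_def)
    qed simp
    ultimately show ?thesis using K12 by (simp add: sum.union_disjoint)
  qed
  also have "\<dots> = (\<Sum>i\<in>K1 \<union> \<rho> ` K2. l X i - l A i)"
    using K12 disj by (simp add: sum.union_disjoint sum.reindex[OF inj])
  also have "\<dots> \<le> (\<Sum>i<card (K1 \<union> \<rho> ` K2). l (X - A) i)"
  proof (rule lidskii[OF E(3,4) _ E(2) E(5,6)])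
    show "eigenbasis (m + n) (dilation A + dilation (X - A)) wX (l X)" using E(1) dil by simp
    show "K1 \<union> \<rho> ` K2 \<subseteq> {..<m + n}" using K12(5,6) by (auto simp: \<rho>_def q_def)
  qed
  also have "\<dots> = (\<Sum>i<card K. singular_values (X - A) $ i)"
  proof -
    have "card K \<le> q" using card_mono[OF _ K] by (simp add: q_def)
    then show ?thesis unfolding card
      by (intro sum.cong) (auto simp: l_def dilation_eigenvalue_def q_def)
  qed
  finally show ?thesis .
qed

section \<open>Diagonal matrices in orthogonal coordinates\<close>

lemma orthogonal_matrix_cols:
  assumes "orthogonal_matrix n V"
  shows "orthonormal n n (col V)"
proof -
  have V: "V \<in> carrier_mat n n" "V\<^sup>T * V = 1\<^sub>m n" using assms by (auto simp: orthogonal_matrix_def)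
  have "col V i \<bullet> col V j = (if i = j then 1 else 0)" if "i < n" "j < n" for i j
  proof -
    have "(V\<^sup>T * V) $$ (i, j) = col V i \<bullet> col V j" using V(1) that by simp
    then show ?thesis using V(2) that by simp
  qed
  then show ?thesis using V(1) by (auto simp: orthonormal_def)
qed

lemma col_mult_Diag:
  assumes "U \<in> carrier_mat m m" "j < n"
  shows "col (U * Diag m n z) j = (if j < m then z $ j \<cdot>\<^sub>v col U j else 0\<^sub>v m)"
proof (rule eq_vecI)
  fix i assume "i < dim_vec (if j < m then z $ j \<cdot>\<^sub>v col U j else 0\<^sub>v m)"
  then have i: "i < m" using assms(1) by (simp split: if_splits)
  have "col (U * Diag m n z) j $ i = (\<Sum>k<m. U $$ (i, k) * Diag m n z $$ (k, j))"
    using assms i by (simp add: Diag_def scalar_prod_def atLeast0LessThan)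
  also have "\<dots> = (\<Sum>k<m. if k = j then z $ j * U $$ (i, j) else 0)"
    using assms by (intro sum.cong) (auto simp: Diag_def)
  finally show "col (U * Diag m n z) j $ i = (if j < m then z $ j \<cdot>\<^sub>v col U j else 0\<^sub>v m) $ i"
    using i assms by simp
qed (use assms in simp)

lemma orthogonal_Diag_mult_col:
  assumes U: "orthogonal_matrix m U" and V: "orthogonal_matrix n V" and j: "j < n"
  shows "(U * Diag m n z * V\<^sup>T) *\<^sub>v col V j = (if j < m then z $ j \<cdot>\<^sub>v col U j else 0\<^sub>v m)"
proof -
  have c: "U \<in> carrier_mat m m" "V \<in> carrier_mat n n" "V\<^sup>T * V = 1\<^sub>m n"
    using U V by (auto simp: orthogonal_matrix_def)
  have UD: "U * Diag m n z \<in> carrier_mat m n" using c(1) by simp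
  then have UDV: "U * Diag m n z * V\<^sup>T \<in> carrier_mat m n" using c(2) by simp
  have "U * Diag m n z * V\<^sup>T * V = U * Diag m n z * (V\<^sup>T * V)"
    by (rule assoc_mult_mat[OF UD _ c(2)]) (use c in simp)
  also have "\<dots> = U * Diag m n z" unfolding c(3) by (rule right_mult_one_mat[OF UD])
  finally have "col (U * Diag m n z * V\<^sup>T * V) j = col (U * Diag m n z) j" by simp
  then show ?thesis using col_mult2[OF UDV c(2) j] col_mult_Diag[OF c(1) j] by simp
qed

lemma transpose_orthogonal_Diag:
  assumes "U \<in> carrier_mat m m" "V \<in> carrier_mat n n"
  shows "(U * Diag m n z * V\<^sup>T)\<^sup>T = V * Diag n m z * U\<^sup>T"
proof -
  have "(Diag m n z)\<^sup>T = Diag n m z" by (intro eq_matI) (auto simp: Diag_def)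
  then have "(U * Diag m n z)\<^sup>T = Diag n m z * U\<^sup>T"
    using transpose_mult[OF assms(1), of "Diag m n z" n] by simp
  then have "(U * Diag m n z * V\<^sup>T)\<^sup>T = V * (Diag n m z * U\<^sup>T)"
    using transpose_mult[of "U * Diag m n z" m n "V\<^sup>T" n] assms by simp
  also have "\<dots> = V * Diag n m z * U\<^sup>T"
    by (rule assoc_mult_mat[symmetric, OF assms(2), of _ m _ m]) (use assms in auto)
  finally show ?thesis .
qed

lemma singular_system_orthogonal_Diag:
  assumes U: "orthogonal_matrix m U" and V: "orthogonal_matrix n V"
  shows "singular_system m n (U * Diag m n z * V\<^sup>T) (col U) (col V) (\<lambda>i. z $ i)"
proof -
  have c: "U \<in> carrier_mat m m" "V \<in> carrier_mat n n"
    using U V by (auto simp: orthogonal_matrix_def)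
  show ?thesis unfolding singular_system_def transpose_orthogonal_Diag[OF c]
    using orthogonal_matrix_cols[OF U] orthogonal_matrix_cols[OF V]
      orthogonal_Diag_mult_col[OF U V] orthogonal_Diag_mult_col[OF V U] c by auto
qed

lemma singular_system_eigenbasis:
  assumes "singular_system m n X u v s"
  shows "eigenbasis n (X\<^sup>T * X) v (\<lambda>j. if j < m then (s j)\<^sup>2 else 0)"
proof -
  have X: "X \<in> carrier_mat m n" and u: "orthonormal m m u" and v: "orthonormal n n v"
    using assms by (auto simp: singular_system_def)
  have "X\<^sup>T * X *\<^sub>v v j = (if j < m then (s j)\<^sup>2 else 0) \<cdot>\<^sub>v v j" if j: "j < n" for j
  proof -
    have vc: "v j \<in> carrier_vec n" using orthonormal_carrier[OF v j] .
    have "X\<^sup>T * X *\<^sub>v v j = X\<^sup>T *\<^sub>v (X *\<^sub>v v j)" using X vc by simp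
    also have "\<dots> = X\<^sup>T *\<^sub>v (if j < m then s j \<cdot>\<^sub>v u j else 0\<^sub>v m)"
      using assms j by (simp add: singular_system_def)
    also have "\<dots> = (if j < m then (s j)\<^sup>2 else 0) \<cdot>\<^sub>v v j"
    proof (cases "j < m")
      case True
      have "X\<^sup>T *\<^sub>v (s j \<cdot>\<^sub>v u j) = s j \<cdot>\<^sub>v (X\<^sup>T *\<^sub>v u j)"
        by (rule mult_mat_vec[of _ n m]) (use X orthonormal_carrier[OF u True] in auto)
      also have "X\<^sup>T *\<^sub>v u j = s j \<cdot>\<^sub>v v j" using assms j True by (simp add: singular_system_def)
      finally show ?thesis using True by (simp add: smult_smult_assoc power2_eq_square)
    next
      case False
      have "X\<^sup>T *\<^sub>v 0\<^sub>v m = 0\<^sub>v n" using X by (intro eq_vecI) auto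
      moreover have "0 \<cdot>\<^sub>v v j = 0\<^sub>v n" using vc by (intro eq_vecI) auto
      ultimately show ?thesis using False by simp
    qed
    finally show ?thesis .
  qed
  then show ?thesis using X v by (simp add: eigenbasis_def)
qed

text \<open>
  The squares of the entries of \<open>z\<close>, padded with zeros, are the eigenvalues of \<open>X\<^sup>T X\<close>. The
  permutation that sorts the absolute values fixes the padded positions, where it keeps the
  eigenvalue zero.
\<close>
theorem singular_values_orthogonal_Diag:
  assumes U: "orthogonal_matrix m U" and V: "orthogonal_matrix n V"
    and p: "p permutes {..<min m n}" and anti: "antimono_on {..<min m n} (\<lambda>i. \<bar>z $ p i\<bar>)"
  shows "singular_values (U * Diag m n z * V\<^sup>T) = vec (min m n) (\<lambda>i. \<bar>z $ p i\<bar>)"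
proof -
  define X where "X = U * Diag m n z * V\<^sup>T"
  have sys: "singular_system m n X (col U) (col V) (\<lambda>i. z $ i)"
    unfolding X_def by (rule singular_system_orthogonal_Diag[OF U V])
  then have X: "X \<in> carrier_mat m n" by (simp add: singular_system_def)
  define d where "d j = (if j < m then (z $ j)\<^sup>2 else 0)" for j
  have pn: "p permutes {..<n}" by (rule permutes_subset[OF p]) auto
  have E: "eigenbasis n (X\<^sup>T * X) (col V \<circ> p) (d \<circ> p)"
    using eigenbasis_permute[OF singular_system_eigenbasis[OF sys] pn]
    unfolding d_def[abs_def] by simp
  have dp: "(d \<circ> p) j = (if j < min m n then \<bar>z $ p j\<bar>\<^sup>2 else 0)" if "j < n" for j
  proof (cases "j < min m n")
    case True
    then have "p j < min m n" using permutes_in_image[OF p, of j] by simp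
    then show ?thesis using True by (simp add: d_def)
  next
    case False
    then have "p j = j" using permutes_not_in[OF p, of j] by simp
    then show ?thesis using False that by (simp add: d_def)
  qed
  have "antimono_on {..<n} (d \<circ> p)"
  proof (rule monotone_onI)
    fix i j assume ij: "i \<in> {..<n}" "j \<in> {..<n}" "i \<le> j"
    have "\<bar>z $ p j\<bar>\<^sup>2 \<le> \<bar>z $ p i\<bar>\<^sup>2" if "j < min m n"
      using that ij(3) anti by (intro power_mono) (auto simp: monotone_on_def)
    then show "(d \<circ> p) j \<le> (d \<circ> p) i" using dp[of i] dp[of j] ij by auto
  qed
  from singular_values_eq_sqrt_eigenvalues[OF X E this]
  have "singular_values X $ i = \<bar>z $ p i\<bar>" if "i < min m n" for i
    using dp[of i] that by simp
  then show ?thesis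
    using singular_values_carrier[OF X] by (intro eq_vecI) (auto simp: X_def)
qed

section \<open>Spectral functions\<close>

text \<open>
  Taking absolute values is the action of a sign matrix \<open>J\<close> that depends on \<open>x\<close>.
\<close>
lemma absolutely_symmetric_sort_abs:
  assumes f: "absolutely_symmetric q f" and x: "x \<in> carrier_vec q" and p: "p permutes {..<q}"
  shows "f (vec q (\<lambda>i. \<bar>x $ p i\<bar>)) = f x"
proof -
  define P :: "real mat" where "P = mat q q (\<lambda>(i, j). if j = p i then 1 else 0)"
  define J :: "real mat" where
    "J = mat q q (\<lambda>(i, j). if i = j then (if x $ i < 0 then - 1 else 1) else 0)"
  have P: "permutation_matrix q P"
    using p unfolding permutation_matrix_def P_def atLeast0LessThan by blast
  have J: "sign_matrix q J" by (auto simp: sign_matrix_def J_def diagonal_mat_def)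
  have c: "P \<in> carrier_mat q q" "J \<in> carrier_mat q q" by (simp_all add: P_def J_def)
  have Jx: "J *\<^sub>v x = vec q (\<lambda>i. \<bar>x $ i\<bar>)"
  proof (rule eq_vecI)
    fix i assume "i < dim_vec (vec q (\<lambda>i. \<bar>x $ i\<bar>))"
    then have i: "i < q" by simp
    have "(J *\<^sub>v x) $ i = (\<Sum>k<q. J $$ (i, k) * x $ k)"
      using i x c(2) by (simp add: scalar_prod_def atLeast0LessThan)
    also have "\<dots> = (\<Sum>k<q. if k = i then \<bar>x $ k\<bar> else 0)"
      using i by (intro sum.cong) (auto simp: J_def)
    finally show "(J *\<^sub>v x) $ i = vec q (\<lambda>i. \<bar>x $ i\<bar>) $ i" using i by simp
  qed (simp add: J_def)
  have "P *\<^sub>v vec q (\<lambda>i. \<bar>x $ i\<bar>) = vec q (\<lambda>i. \<bar>x $ p i\<bar>)"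
  proof (rule eq_vecI)
    fix i assume "i < dim_vec (vec q (\<lambda>i. \<bar>x $ p i\<bar>))"
    then have i: "i < q" "p i < q" using permutes_in_image[OF p, of i] by auto
    have "(P *\<^sub>v vec q (\<lambda>i. \<bar>x $ i\<bar>)) $ i = (\<Sum>k<q. P $$ (i, k) * \<bar>x $ k\<bar>)"
      using i c(1) by (simp add: scalar_prod_def atLeast0LessThan)
    also have "\<dots> = (\<Sum>k<q. if k = p i then \<bar>x $ k\<bar> else 0)"
      using i by (intro sum.cong) (auto simp: P_def)
    finally show "(P *\<^sub>v vec q (\<lambda>i. \<bar>x $ i\<bar>)) $ i = vec q (\<lambda>i. \<bar>x $ p i\<bar>) $ i"
      using i by simp
  qed (simp add: P_def)
  then have "(P * J) *\<^sub>v x = vec q (\<lambda>i. \<bar>x $ p i\<bar>)" using assoc_mult_mat_vec[OF c x] Jx by simp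
  then show ?thesis using f x P J unfolding absolutely_symmetric_def by metis
qed

lemma decreasing_rearrangement_permutation:
  assumes x: "x \<in> carrier_vec q" and p: "p permutes {..<q}"
    and anti: "antimono_on {..<q} (\<lambda>i. x $ p i)" and i: "i < q"
  shows "decreasing_rearrangement x ! i = x $ p i"
proof -
  have "mset [0..<q] = mset_set {..<q}" by (simp add: atLeast0LessThan)
  moreover have "image_mset p (mset_set {..<q}) = mset_set {..<q}"
    using image_mset_mset_set[OF permutes_inj_on[OF p, of "{..<q}"]] permutes_image[OF p] by simp
  moreover have "mset (map (\<lambda>i. x $ p i) [0..<q]) = image_mset (\<lambda>i. x $ i) (image_mset p (mset [0..<q]))"
    by (simp add: multiset.map_comp o_def)
  ultimately have "mset (map (\<lambda>i. x $ p i) [0..<q]) = mset (map (\<lambda>i. x $ i) [0..<q])"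
    by (simp only: mset_map)
  moreover have "list_of_vec x = map (\<lambda>i. x $ i) [0..<q]"
    using x by (intro nth_equalityI) (auto simp: list_of_vec_index)
  ultimately have "rev (sort (list_of_vec x)) = map (\<lambda>i. x $ p i) [0..<q]"
    by (intro rev_sort_eq_map[OF anti]) simp
  then show ?thesis using i by (simp add: decreasing_rearrangement_def)
qed

text \<open>
  The \<open>k\<close> largest entries of the left-hand vector sit at some set \<open>K\<close> of \<open>k\<close> positions, so the
  bound for arbitrary index sets gives each of the inequalities.
\<close>
lemma singular_values_weak_majorization:
  assumes X: "X \<in> carrier_mat m n" and A: "A \<in> carrier_mat m n"
  shows "vec (min m n) (\<lambda>i. \<bar>(singular_values X - singular_values A) $ i\<bar>) \<prec>\<^sub>w
    singular_values (X - A)"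
proof -
  define q where "q = min m n"
  define w where "w = vec q (\<lambda>i. \<bar>(singular_values X - singular_values A) $ i\<bar>)"
  have w: "w \<in> carrier_vec q" by (simp add: w_def)
  have Z: "X - A \<in> carrier_mat m n" using A by (rule minus_carrier_mat)
  define z where "z = singular_values (X - A)"
  have z: "z \<in> nonneg_decreasing_vecs q"
    using singular_value_decomposition[OF Z] by (auto simp: z_def q_def)
  then have zc: "z \<in> carrier_vec q" by (simp add: nonneg_decreasing_vecs_def)
  obtain p where p: "p permutes {..<q}" "antimono_on {..<q} ((\<lambda>i. w $ i) \<circ> p)"
    by (rule sorting_permutation)
  have "(\<Sum>i<k. decreasing_rearrangement w ! i) \<le> (\<Sum>i<k. decreasing_rearrangement z ! i)"
    if k: "k \<le> q" for k
  proof -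
    have inj: "inj_on p {..<k}" using permutes_inj_on[OF p(1)] .
    have sub: "p ` {..<k} \<subseteq> {..<q}" using permutes_image[OF p(1)] k by (metis image_mono lessThan_subset_iff)
    have "(\<Sum>i<k. decreasing_rearrangement w ! i) = (\<Sum>i<k. w $ p i)"
      using decreasing_rearrangement_permutation[OF w p(1)] p(2) k by (simp add: o_def)
    also have "\<dots> = (\<Sum>i\<in>p ` {..<k}. w $ i)" by (simp add: sum.reindex[OF inj])
    also have "\<dots> = (\<Sum>i\<in>p ` {..<k}. \<bar>singular_values X $ i - singular_values A $ i\<bar>)"
    proof (rule sum.cong)
      fix i assume "i \<in> p ` {..<k}"
      with sub have "i < q" by auto
      then show "w $ i = \<bar>singular_values X $ i - singular_values A $ i\<bar>"
        using singular_values_carrier[OF A] by (simp add: w_def q_def)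
    qed simp
    also have "\<dots> \<le> (\<Sum>i<card (p ` {..<k}). z $ i)"
      unfolding z_def by (rule mirsky[OF X A]) (use sub in \<open>simp add: q_def\<close>)
    also have "\<dots> = (\<Sum>i<k. z $ i)" by (simp add: card_image[OF inj])
    also have "\<dots> = (\<Sum>i<k. decreasing_rearrangement z ! i)"
    proof (rule sum.cong)
      fix i assume "i \<in> {..<k}"
      then show "z $ i = decreasing_rearrangement z ! i"
        using decreasing_rearrangement_permutation[OF zc permutes_id, of i] z k
        by (auto simp: nonneg_decreasing_vecs_def monotone_on_def)
    qed simp
    finally show ?thesis .
  qed
  then show ?thesis using w zc by (simp add: weakly_majorized_def w_def z_def q_def)
qed

text \<open>
  Although the entries of \<open>z\<close> may be unsorted and negative, as those of \<open>x - \<sigma>(A)\<close> are, absolute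
  symmetry hides their order and signs.
\<close>
lemma spectral_function_orthogonal_Diag:
  assumes f: "absolutely_symmetric (min m n) f"
    and U: "orthogonal_matrix m U" and V: "orthogonal_matrix n V" and z: "z \<in> carrier_vec (min m n)"
  shows "spectral_function f (U * Diag m n z * V\<^sup>T) = f z"
proof -
  obtain p where p: "p permutes {..<min m n}" "antimono_on {..<min m n} ((\<lambda>i. \<bar>z $ i\<bar>) \<circ> p)"
    by (rule sorting_permutation)
  have "singular_values (U * Diag m n z * V\<^sup>T) = vec (min m n) (\<lambda>i. \<bar>z $ p i\<bar>)"
    using singular_values_orthogonal_Diag[OF U V p(1)] p(2) by (simp add: o_def)
  then show ?thesis using absolutely_symmetric_sort_abs[OF f z p(1)] by (simp add: spectral_function_def)
qed

lemma spectral_function_diff_ge: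
  assumes f: "absolutely_symmetric (min m n) f" "weak_majorization_monotone (min m n) f"
    and X: "X \<in> carrier_mat m n" and A: "A \<in> carrier_mat m n"
  shows "f (singular_values X - singular_values A) \<le> spectral_function f (X - A)"
proof -
  define q where "q = min m n"
  define x where "x = singular_values X - singular_values A"
  have x: "x \<in> carrier_vec q"
    using minus_carrier_vec[OF singular_values_carrier[OF X] singular_values_carrier[OF A]]
    by (simp add: x_def q_def)
  have Z: "X - A \<in> carrier_mat m n" using A by (rule minus_carrier_mat)
  have "f x = f (vec q (\<lambda>i. \<bar>x $ i\<bar>))"
    using absolutely_symmetric_sort_abs[of q f x id] f(1) x by (simp add: q_def permutes_id)
  also have "\<dots> \<le> f (singular_values (X - A))"
  proof -
    have "singular_values (X - A) \<in> nonneg_orthant q"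
      using singular_value_decomposition[OF Z]
      by (auto simp: nonneg_orthant_def nonneg_decreasing_vecs_def q_def)
    moreover have "vec q (\<lambda>i. \<bar>x $ i\<bar>) \<in> nonneg_orthant q" by (simp add: nonneg_orthant_def)
    ultimately show ?thesis
      using f(2) singular_values_weak_majorization[OF X A]
      by (simp add: weak_majorization_monotone_def q_def x_def)
  qed
  finally show ?thesis by (simp add: spectral_function_def x_def)
qed

section \<open>Equivalence of the matrix and the vector problem\<close>

theorem theorem3p2:
  fixes m n q :: nat
    and A U V :: "real mat"
    and c \<mu> :: real
    and f\<^sub>1 f\<^sub>2 g :: "real vec \<Rightarrow> ereal"
    and F\<^sub>1 F\<^sub>2 G :: "real mat \<Rightarrow> ereal"
  assumes "m \<ge> 1" and "n \<ge> 1" and "q = min m n"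
    and "A \<in> carrier_mat m n"
    and "\<mu> \<ge> 0"
    and "proper q f\<^sub>1" and "absolutely_symmetric q f\<^sub>1"
    and "proper q f\<^sub>2" and "absolutely_symmetric q f\<^sub>2"
    and "proper q g" and "absolutely_symmetric q g"
    and "F\<^sub>1 = spectral_function f\<^sub>1"
    and "F\<^sub>2 = spectral_function f\<^sub>2"
    and "G = spectral_function g"
    and "weak_majorization_monotone q f\<^sub>1"
    and "orthogonal_matrix m U" and "orthogonal_matrix n V"
    and "A = U * Diag m n (singular_values A) * V\<^sup>T"
  shows "((\<exists>X. matrix_problem_solution m n F\<^sub>1 F\<^sub>2 G A \<mu> c X) \<longleftrightarrow>
            (\<exists>x. vector_problem_solution q f\<^sub>1 f\<^sub>2 g (singular_values A) \<mu> c x)) \<and>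
         (\<forall>x. vector_problem_solution q f\<^sub>1 f\<^sub>2 g (singular_values A) \<mu> c x \<longrightarrow>
            matrix_problem_solution m n F\<^sub>1 F\<^sub>2 G A \<mu> c (U * Diag m n x * V\<^sup>T)) \<and>
         (\<forall>X. matrix_problem_solution m n F\<^sub>1 F\<^sub>2 G A \<mu> c X \<longrightarrow>
            vector_problem_solution q f\<^sub>1 f\<^sub>2 g (singular_values A) \<mu> c (singular_values X))"
proof -
  define s where "s = singular_values A"
  define lift where "lift x = U * Diag m n x * V\<^sup>T" for x
  define \<Phi> where "\<Phi> X = F\<^sub>1 (X - A) + ereal \<mu> * F\<^sub>2 X" for X
  define \<phi> where "\<phi> x = f\<^sub>1 (x - s) + ereal \<mu> * f\<^sub>2 x" for x
  have UV: "U \<in> carrier_mat m m" "V \<in> carrier_mat n n"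
    using assms(16,17) by (auto simp: orthogonal_matrix_def)
  have s: "s \<in> carrier_vec q" using singular_values_carrier[OF assms(4)] assms(3) by (simp add: s_def)
  have lift: "lift x \<in> carrier_mat m n" for x unfolding lift_def
    by (rule mult_carrier_mat[of _ m n], rule mult_carrier_mat[OF UV(1)]) (use UV in simp_all)
  have spectral_lift: "spectral_function f (lift x) = f x"
    if "absolutely_symmetric q f" "x \<in> carrier_vec q" for f x
    using spectral_function_orthogonal_Diag[of m n f U V x] that assms(3,16,17) by (simp add: lift_def)
  have lift_minus: "lift x - A = lift (x - s)" if "x \<in> carrier_vec q" for x
  proof -
    have "Diag m n x - Diag m n s = Diag m n (x - s)"
      using that s assms(3) by (intro eq_matI) (auto simp: Diag_def)
    moreover have "A = lift s" unfolding lift_def s_def by (rule assms(18))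
    moreover have "lift x - lift s = U * (Diag m n x - Diag m n s) * V\<^sup>T"
      unfolding lift_def
      using mult_minus_distrib_mat[OF UV(1) Diag_carrier[of m n x] Diag_carrier[of m n s]]
        minus_mult_distrib_mat[OF mult_carrier_mat[OF UV(1) Diag_carrier[of m n x]]
          mult_carrier_mat[OF UV(1) Diag_carrier[of m n s]], of "V\<^sup>T" n] UV(2)
      by simp
    ultimately show ?thesis by (simp add: lift_def)
  qed
  have obj_lift: "\<Phi> (lift x) = \<phi> x" if "x \<in> carrier_vec q" for x
    using that s assms(7,9,12,13) lift_minus[OF that]
    by (simp add: \<Phi>_def \<phi>_def spectral_lift)
  have obj_sv: "\<phi> (singular_values X) \<le> \<Phi> X" if "X \<in> carrier_mat m n" for X
  proof -
    have "f\<^sub>1 (singular_values X - s) \<le> F\<^sub>1 (X - A)"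
      using spectral_function_diff_ge[of m n f\<^sub>1 X A] assms(3,4,7,12,15) that by (simp add: s_def)
    then show ?thesis
      unfolding \<Phi>_def \<phi>_def assms(13) spectral_function_def by (rule add_right_mono)
  qed
  have sv: "singular_values X \<in> nonneg_decreasing_vecs q" if "X \<in> carrier_mat m n" for X
    using singular_value_decomposition[OF that] assms(3) by metis
  have carrier: "x \<in> carrier_vec q" if "x \<in> nonneg_decreasing_vecs q" for x
    using that by (simp add: nonneg_decreasing_vecs_def)
  have vm: "matrix_problem_solution m n F\<^sub>1 F\<^sub>2 G A \<mu> c (lift x)"
    if "vector_problem_solution q f\<^sub>1 f\<^sub>2 g s \<mu> c x" for x
  proof -
    have x: "x \<in> nonneg_decreasing_vecs q" "g x \<le> ereal c"
      and min: "\<And>y. y \<in> nonneg_decreasing_vecs q \<Longrightarrow> g y \<le> ereal c \<Longrightarrow> \<phi> x \<le> \<phi> y"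
      using that by (auto simp: vector_problem_solution_def optimal_solution_def \<phi>_def)
    have "\<Phi> (lift x) \<le> \<Phi> X" if X: "X \<in> carrier_mat m n" "G X \<le> ereal c" for X
    proof -
      have "\<phi> x \<le> \<phi> (singular_values X)"
        using X min[OF sv[OF X(1)]] by (simp add: assms(14) spectral_function_def)
      with obj_lift[OF carrier[OF x(1)]] obj_sv[OF X(1)] show ?thesis by simp
    qed
    moreover have "G (lift x) \<le> ereal c"
      using x(2) spectral_lift[OF assms(11) carrier[OF x(1)]] by (simp add: assms(14))
    ultimately show ?thesis using lift
      by (simp add: matrix_problem_solution_def optimal_solution_def \<Phi>_def)
  qed
  have mv: "vector_problem_solution q f\<^sub>1 f\<^sub>2 g s \<mu> c (singular_values X)"
    if "matrix_problem_solution m n F\<^sub>1 F\<^sub>2 G A \<mu> c X" for X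
  proof -
    have X: "X \<in> carrier_mat m n" "G X \<le> ereal c"
      and min: "\<And>Y. Y \<in> carrier_mat m n \<Longrightarrow> G Y \<le> ereal c \<Longrightarrow> \<Phi> X \<le> \<Phi> Y"
      using that by (auto simp: matrix_problem_solution_def optimal_solution_def \<Phi>_def)
    have "\<phi> (singular_values X) \<le> \<phi> y" if y: "y \<in> nonneg_decreasing_vecs q" "g y \<le> ereal c" for y
    proof -
      have "G (lift y) \<le> ereal c"
        using y(2) spectral_lift[OF assms(11) carrier[OF y(1)]] by (simp add: assms(14))
      from min[OF lift this] obj_lift[OF carrier[OF y(1)]] obj_sv[OF X(1)] show ?thesis by simp
    qed
    moreover have "g (singular_values X) \<le> ereal c"
      using X(2) by (simp add: assms(14) spectral_function_def)
    ultimately show ?thesis using sv[OF X(1)]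
      by (simp add: vector_problem_solution_def optimal_solution_def \<phi>_def)
  qed
  from vm mv show ?thesis unfolding s_def lift_def by blast
qed

end
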